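(* Let $\kappa$ be a regular limit cardinal with $\kappa^{<\kappa}=\kappa$, let $\mu<\kappa$ be an (infinite) regular cardinal, and let $S\subseteq\{\alpha<\kappa:\operatorname{cf}(\alpha)=\mu\}$ be stationary in $\kappa$. Then $\mathbb{Q}^{\rm Sacks}_\kappa \Vdash \diamondsuit_\kappa(S)$, and likewise $\mathbb{Q}^{\rm Silver}_\kappa \Vdash \diamondsuit_\kappa(S)$.
   Context: Diamond: for a cardinal $\kappa$ of uncountable cofinality and stationary $S\subseteq\kappa$, $\diamondsuit_\kappa(S)$ says: there is a sequence $\langle d_\delta:\delta\in S\rangle$ with $d_\delta\in{}^\delta 2$ such that for every $x\in{}^\kappa2$ the set $\{\delta\in S: d_\delta=x\restriction\delta\}$ is stationary in $\kappa$. Forcing convention: $p\le q$ means $q$ is stronger than $p$; $\mathbb{P}\Vdash\varphi$ means that every condition of $\mathbb{P}$ forces $\varphi$. Trees: ${}^{\kappa>}2$ is the set of functions $t:\alpha\to2$ with $\alpha<\kappa$. A tree is a non-empty subset of ${}^{\kappa>}2$ closed under initial segments; $\trianglelefteq$ is the initial segment relation. A splitting node of a tree $p$ is a node of $p$ with at least two immediate successors in $p$. $\mathbb{Q}^{\rm Sacks}_\kappa$ (for regular $\kappa$ with $\kappa^{<\kappa}=\kappa$): conditions are trees $p\subseteq{}^{\kappa>}2$ such that (1) every $s\in p$ has an extension $t\trianglerighteq s$ in $p$ that has two immediate successors in $p$; (2) for every strictly increasing sequence of splitting nodes of $p$ of limit length $<\kappa$, the union of the sequence is a splitting node of $p$.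 A condition $q$ is stronger than $p$ iff $q\subseteq p$. $\mathbb{Q}^{\rm Silver}_\kappa$ (for regular $\kappa$ with $\kappa^{<\kappa}=\kappa$): conditions are partial functions $f:\operatorname{dom}(f)\to2$ where $\operatorname{dom}(f)\subseteq\kappa$ is a non-stationary subset of $\kappa$. Stronger conditions are extensions of the function $f$. *)

theory Defs
  imports Main
begin

unbundle cardinal_syntax

section \<open>Ordinals and cardinals\<close>

text \<open>
  The cardinal \<open>\<kappa>\<close> is a well-ordered type \<open>'k\<close>: its elements are the ordinals below \<open>\<kappa>\<close>, and
  \<open>\<alpha> < \<kappa>\<close>, viewed as a set of ordinals, is \<open>{..<\<alpha>}\<close>.  That \<open>'k\<close> is a cardinal with the required
  properties is an assumption on the relation \<open>ord_rel (UNIV :: 'k set)\<close>.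
\<close>

definition ord_rel :: "'k::wellorder set \<Rightarrow> 'k rel" where
  "ord_rel A = {(\<alpha>, \<beta>). \<alpha> \<in> A \<and> \<beta> \<in> A \<and> \<alpha> \<le> \<beta>}"

definition infinite_regular_cardinal :: "'a rel \<Rightarrow> bool" where
  "infinite_regular_cardinal r \<longleftrightarrow> Cinfinite r \<and> regularCard r"

text \<open>Every cardinal below the cardinal \<open>r\<close> on \<open>'a\<close> is the cardinality of some set of type \<open>'a set\<close>.\<close>

definition limit_cardinal :: "'a rel \<Rightarrow> bool" where
  "limit_cardinal r \<longleftrightarrow> Cinfinite r \<and> (\<forall>A :: 'a set. |A| <o r \<longrightarrow> cardSuc |A| <o r)"

text \<open>
  A function \<open>t : \<alpha> \<rightarrow> X\<close> with \<open>\<alpha> < \<kappa>\<close> is a partial map with domain \<open>{..<\<alpha>}\<close>.  Initial segment is \<open>\<subseteq>\<^sub>m\<close>.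
\<close>

definition seqs :: "('k::wellorder \<rightharpoonup> 'b) set" where
  "seqs = {t. \<exists>\<alpha>. dom t = {..<\<alpha>}}"

text \<open>The cofinality of an ordinal \<open>\<alpha> < \<kappa>\<close>: the least domain of a map cofinal in \<open>\<alpha>\<close>.\<close>

definition cof :: "'k::wellorder \<Rightarrow> 'k" where
  "cof \<alpha> = (LEAST \<gamma>. \<exists>f. f ` {..<\<gamma>} \<subseteq> {..<\<alpha>} \<and> (\<forall>\<beta><\<alpha>. \<exists>\<xi><\<gamma>. \<beta> \<le> f \<xi>))"

definition limit_ordinal :: "'k::wellorder \<Rightarrow> bool" where
  "limit_ordinal \<delta> \<longleftrightarrow> (\<exists>\<beta>. \<beta> < \<delta>) \<and> (\<forall>\<beta><\<delta>. \<exists>\<gamma>. \<beta> < \<gamma> \<and> \<gamma> < \<delta>)"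

definition club :: "'k::wellorder set \<Rightarrow> bool" where
  "club C \<longleftrightarrow> (\<forall>\<alpha>. \<exists>\<beta>\<in>C. \<alpha> < \<beta>) \<and>
     (\<forall>\<delta>. limit_ordinal \<delta> \<longrightarrow> (\<forall>\<beta><\<delta>. \<exists>\<gamma>\<in>C. \<beta> < \<gamma> \<and> \<gamma> < \<delta>) \<longrightarrow> \<delta> \<in> C)"

definition stationary :: "'k::wellorder set \<Rightarrow> bool" where
  "stationary S \<longleftrightarrow> (\<forall>C. club C \<longrightarrow> C \<inter> S \<noteq> {})"


section \<open>Forcing\<close>

text \<open>
  A forcing notion is the relation \<open>R\<close> of all pairs \<open>(p, q)\<close> of conditions such that \<open>q\<close> is stronger
  than \<open>p\<close>; it is reflexive on the conditions, so the set of conditions is \<open>Field R\<close>.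

  Diamond is a statement about elements and subsets of ground model sets, so we only need names for
  subsets of ground model sets \<open>A\<close>.  Such a name is a set of pairs \<open>(a, s)\<close> with \<open>a \<in> A\<close> and \<open>s\<close> a
  condition, i.e. a name in the usual sense whose first components are the check names of elements
  of \<open>A\<close>.  Every subset of \<open>A\<close> in a generic extension is the value of such a name, so quantifying
  over these names is quantifying over all subsets of \<open>A\<close> in the extension.

  A sentence of the forcing language is represented by the predicate of being a condition that
  forces it.  The clauses for membership, negation, conjunction and universal quantification are
  those of the usual recursive definition of the forcing relation; the other connectives are the
  classical abbreviations.
\<close>

type_synonym ('a, 'p) name = "('a \<times> 'p) set"
type_synonym 'p sentence = "'p \<Rightarrow> bool"

text \<open>\<open>p\<close> forces \<open>a \<in> \<tau>\<close> iff every condition stronger than \<open>p\<close> has a further strengthening that is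
  stronger than some \<open>s\<close> with \<open>(a, s) \<in> \<tau>\<close>.\<close>

definition f_mem :: "'p rel \<Rightarrow> 'a \<Rightarrow> ('a, 'p) name \<Rightarrow> 'p sentence" where
  "f_mem R a \<tau> = (\<lambda>p. \<forall>q. (p, q) \<in> R \<longrightarrow> (\<exists>r. (q, r) \<in> R \<and> (\<exists>s. (a, s) \<in> \<tau> \<and> (s, r) \<in> R)))"

definition f_not :: "'p rel \<Rightarrow> 'p sentence \<Rightarrow> 'p sentence" where
  "f_not R \<phi> = (\<lambda>p. \<forall>q. (p, q) \<in> R \<longrightarrow> \<not> \<phi> q)"

definition f_and :: "'p sentence \<Rightarrow> 'p sentence \<Rightarrow> 'p sentence" where
  "f_and \<phi> \<psi> = (\<lambda>p. \<phi> p \<and> \<psi> p)"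

definition f_imp :: "'p rel \<Rightarrow> 'p sentence \<Rightarrow> 'p sentence \<Rightarrow> 'p sentence" where
  "f_imp R \<phi> \<psi> = f_not R (f_and \<phi> (f_not R \<psi>))"

definition f_iff :: "'p rel \<Rightarrow> 'p sentence \<Rightarrow> 'p sentence \<Rightarrow> 'p sentence" where
  "f_iff R \<phi> \<psi> = f_and (f_imp R \<phi> \<psi>) (f_imp R \<psi> \<phi>)"

text \<open>
  Quantifiers ranging over a ground model set \<open>A\<close> (ordinals below \<open>\<kappa>\<close>, bits) and quantifiers ranging
  over all names for subsets of a ground model set.
\<close>

definition f_ball :: "'a set \<Rightarrow> ('a \<Rightarrow> 'p sentence) \<Rightarrow> 'p sentence" where
  "f_ball A \<phi> = (\<lambda>p. \<forall>a\<in>A. \<phi> a p)"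

definition f_bex :: "'p rel \<Rightarrow> 'a set \<Rightarrow> ('a \<Rightarrow> 'p sentence) \<Rightarrow> 'p sentence" where
  "f_bex R A \<phi> = f_not R (f_ball A (\<lambda>a. f_not R (\<phi> a)))"

definition f_all_names :: "(('a, 'p) name \<Rightarrow> 'p sentence) \<Rightarrow> 'p sentence" where
  "f_all_names \<phi> = (\<lambda>p. \<forall>\<tau>. \<phi> \<tau> p)"

definition f_ex_names :: "'p rel \<Rightarrow> (('a, 'p) name \<Rightarrow> 'p sentence) \<Rightarrow> 'p sentence" where
  "f_ex_names R \<phi> = f_not R (f_all_names (\<lambda>\<tau>. f_not R (\<phi> \<tau>)))"

definition forced :: "'p rel \<Rightarrow> 'p sentence \<Rightarrow> bool" where
  "forced R \<phi> \<longleftrightarrow> (\<forall>p\<in>Field R. \<phi> p)"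


section \<open>Diamond in the forcing language\<close>

text \<open>\<open>\<tau>\<close> is a function from \<open>A\<close> to \<open>B\<close>, as a subset of \<open>A \<times> B\<close>.\<close>

definition f_function :: "'p rel \<Rightarrow> 'a set \<Rightarrow> 'b set \<Rightarrow> ('a \<times> 'b, 'p) name \<Rightarrow> 'p sentence" where
  "f_function R A B \<tau> =
     f_and (f_ball (- (A \<times> B)) (\<lambda>z. f_not R (f_mem R z \<tau>)))
       (f_ball A (\<lambda>a.
          f_and (f_bex R B (\<lambda>b. f_mem R (a, b) \<tau>))
                (f_ball B (\<lambda>b. f_ball (B - {b}) (\<lambda>c.
                   f_not R (f_and (f_mem R (a, b) \<tau>) (f_mem R (a, c) \<tau>)))))))"

definition f_club :: "'p rel \<Rightarrow> ('k::wellorder, 'p) name \<Rightarrow> 'p sentence" where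
  "f_club R C =
     f_and (f_ball UNIV (\<lambda>\<alpha>. f_bex R {\<alpha><..} (\<lambda>\<beta>. f_mem R \<beta> C)))
       (f_ball {\<delta>. limit_ordinal \<delta>} (\<lambda>\<delta>.
          f_imp R (f_ball {..<\<delta>} (\<lambda>\<beta>. f_bex R {\<beta><..<\<delta>} (\<lambda>\<gamma>. f_mem R \<gamma> C)))
                  (f_mem R \<delta> C)))"

text \<open>The set \<open>{\<delta> \<in> S. \<phi> \<delta>}\<close>, computed in the extension, is stationary in \<open>\<kappa>\<close> there.\<close>

definition f_stationary :: "'p rel \<Rightarrow> 'k::wellorder set \<Rightarrow> ('k \<Rightarrow> 'p sentence) \<Rightarrow> 'p sentence" where
  "f_stationary R S \<phi> =
     f_all_names (\<lambda>C. f_imp R (f_club R C) (f_bex R S (\<lambda>\<delta>. f_and (f_mem R \<delta> C) (\<phi> \<delta>))))"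

text \<open>
  The sequence of the \<open>d\<^sub>\<delta> : \<delta> \<rightarrow> 2\<close> for \<open>\<delta> \<in> S\<close> is one function \<open>(\<delta>, \<alpha>) \<mapsto> d\<^sub>\<delta>(\<alpha>)\<close> on the set of pairs
  with \<open>\<delta> \<in> S\<close> and \<open>\<alpha> < \<delta>\<close>.  The following says \<open>d\<^sub>\<delta> = x \<restriction> \<delta>\<close>.
\<close>

definition f_guess :: "'p rel \<Rightarrow> (('k \<times> 'k) \<times> bool, 'p) name \<Rightarrow> ('k::wellorder \<times> bool, 'p) name
    \<Rightarrow> 'k \<Rightarrow> 'p sentence" where
  "f_guess R d x \<delta> =
     f_ball {..<\<delta>} (\<lambda>\<alpha>. f_ball UNIV (\<lambda>i. f_iff R (f_mem R ((\<delta>, \<alpha>), i) d) (f_mem R (\<alpha>, i) x)))"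

definition f_diamond :: "'p rel \<Rightarrow> 'k::wellorder set \<Rightarrow> 'p sentence" where
  "f_diamond R S =
     f_ex_names R (\<lambda>d.
       f_and (f_function R (SIGMA \<delta>:S. {..<\<delta>}) (UNIV :: bool set) d)
         (f_all_names (\<lambda>x.
            f_imp R (f_function R (UNIV :: 'k set) (UNIV :: bool set) x)
                    (f_stationary R S (f_guess R d x)))))"


section \<open>Sacks and Silver forcing\<close>

definition tree :: "('k::wellorder \<rightharpoonup> bool) set \<Rightarrow> bool" where
  "tree p \<longleftrightarrow> p \<noteq> {} \<and> p \<subseteq> seqs \<and> (\<forall>t\<in>p. \<forall>s\<in>seqs. s \<subseteq>\<^sub>m t \<longrightarrow> s \<in> p)"

definition immediate_succ :: "('k::wellorder \<rightharpoonup> bool) \<Rightarrow> ('k \<rightharpoonup> bool) \<Rightarrow> bool" where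
  "immediate_succ s t \<longleftrightarrow> s \<subseteq>\<^sub>m t \<and> (\<exists>\<alpha>. dom s = {..<\<alpha>} \<and> dom t = {..\<alpha>})"

definition splitting_node :: "('k::wellorder \<rightharpoonup> bool) set \<Rightarrow> ('k \<rightharpoonup> bool) \<Rightarrow> bool" where
  "splitting_node p s \<longleftrightarrow> s \<in> p \<and>
     (\<exists>t\<in>p. \<exists>t'\<in>p. t \<noteq> t' \<and> immediate_succ s t \<and> immediate_succ s t')"

text \<open>In the last clause \<open>u\<close> is the union of the sequence \<open>f\<close>; it exists, since \<open>f\<close> is increasing.\<close>

definition sacks_condition :: "('k::wellorder \<rightharpoonup> bool) set \<Rightarrow> bool" where
  "sacks_condition p \<longleftrightarrow> tree p \<and>
     (\<forall>s\<in>p. \<exists>t. s \<subseteq>\<^sub>m t \<and> splitting_node p t) \<and>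
     (\<forall>(l :: 'k) f. limit_ordinal l \<longrightarrow>
        (\<forall>i<l. splitting_node p (f i)) \<longrightarrow>
        (\<forall>i j. i < j \<longrightarrow> j < l \<longrightarrow> f i \<subseteq>\<^sub>m f j \<and> f i \<noteq> f j) \<longrightarrow>
        (\<forall>u. Map.graph u = (\<Union>i<l. Map.graph (f i)) \<longrightarrow> splitting_node p u))"

definition sacks :: "('k::wellorder \<rightharpoonup> bool) set rel" where
  "sacks = {(p, q). sacks_condition p \<and> sacks_condition q \<and> q \<subseteq> p}"

definition silver_condition :: "('k::wellorder \<rightharpoonup> bool) \<Rightarrow> bool" where
  "silver_condition f \<longleftrightarrow> \<not> stationary (dom f)"

definition silver :: "('k::wellorder \<rightharpoonup> bool) rel" where
  "silver = {(f, g). silver_condition f \<and> silver_condition g \<and> f \<subseteq>\<^sub>m g}"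

end

theory Submission
  imports Defs
begin

text \<open>
  Both forcings add a function \<open>G : \<kappa> \<rightarrow> 2\<close>, and about them only three facts matter: they are closed
  under increasing sequences of length less than \<open>\<kappa>\<close>, every condition can be strengthened to decide
  \<open>G \<restriction> \<delta>\<close>, and every condition has two strengthenings that disagree about a value of \<open>G\<close>.  Every such
  forcing forces the diamond (\<open>forced_diamond\<close>), with the sequence \<open>d\<^sub>\<delta> = D\<^sub>\<delta>(G \<restriction> \<delta>)\<close> for suitable ground
  model functions \<open>D\<^sub>\<delta>\<close> from \<open>2\<^sup>\<delta>\<close> to \<open>2\<^sup>\<delta>\<close>.

  Given names \<open>x\<close> and \<open>C\<close> for a function and a club, and a condition \<open>q\<close>, consider a tree of conditions
  above \<open>q\<close>.  A function \<open>y : \<kappa> \<rightarrow> 2\<close> is a branch: at step \<open>\<alpha>\<close> the bit \<open>y(\<alpha>)\<close> chooses between two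
  strengthenings that disagree about \<open>G\<close>, and the chosen one is strengthened further so that it
  decides \<open>G(\<alpha>)\<close> and \<open>x(\<alpha>)\<close> and forces some ordinal above \<open>\<alpha>\<close> into \<open>C\<close>; at limits one takes bounds.
  The decided values form functions \<open>G\<^sub>y\<close> and \<open>X\<^sub>y\<close> in the ground model.  The maps \<open>y \<mapsto> G\<^sub>y\<close> and
  \<open>y \<mapsto> X\<^sub>y\<close> are causal, that is, their values below \<open>\<alpha>\<close> depend on \<open>y \<restriction> \<alpha>\<close> only, and the first one is
  injective.  If \<open>\<delta>\<close> is closed under the ordinals that occur along \<open>y\<close>, then the condition that \<open>y\<close>
  reaches at \<open>\<delta>\<close> forces \<open>\<delta> \<in> C\<close>, \<open>G \<restriction> \<delta> = G\<^sub>y \<restriction> \<delta>\<close> and \<open>x \<restriction> \<delta> = X\<^sub>y \<restriction> \<delta>\<close>.  So it suffices that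
  \<open>D\<^sub>\<delta>(G\<^sub>y \<restriction> \<delta>) = X\<^sub>y \<restriction> \<delta>\<close> for a single \<open>y\<close>, at club many \<open>\<delta>\<close>.

  The functions \<open>D\<^sub>\<delta>\<close> have to be chosen before \<open>x\<close>, \<open>C\<close> and \<open>q\<close> are known, and this is possible by
  counting (\<open>ex_causal_guessing\<close>).  There are only \<open>\<kappa>\<close> many bounded sequences of bits; enumerate them in
  length \<open>\<kappa>\<close>.  Let \<open>P\<^sub>\<delta>\<close> be the set of all members of \<open>2\<^sup>\<delta>\<close> whose proper initial segments are
  enumerated before \<open>\<delta>\<close>.  A pair of causal maps consists of \<open>\<kappa>\<close> many bounded pieces of information and
  is coded by one member of \<open>2\<^sup>\<kappa>\<close>, whose restriction to \<open>\<delta>\<close> belongs to \<open>P\<^sub>\<delta>\<close> for club many \<open>\<delta>\<close>.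
  Therefore \<open>D\<^sub>\<delta>\<close> has to cope with at most \<open>|P\<^sub>\<delta>|\<close> many pairs \<open>(G, X)\<close>, and for each of them the branches
  \<open>y \<in> P\<^sub>\<delta>\<close> provide \<open>|P\<^sub>\<delta>|\<close> many different arguments \<open>G\<^sub>y \<restriction> \<delta>\<close>.  A diagonalisation of length \<open>|P\<^sub>\<delta>|\<close>
  reserves for each pair an argument of its own and lets \<open>D\<^sub>\<delta>\<close> take the required value there.

  For Silver forcing the three facts hold because unions of fewer than \<open>\<kappa>\<close> nonstationary sets are
  nonstationary.  For Sacks forcing the main point is that the intersection of a decreasing sequence
  of conditions is a condition: the least splitting nodes of these conditions above a given node
  increase, and their union is a splitting node of all of them.
\<close>

section \<open>Regular uncountable cardinals\<close>

text \<open>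
  The ordinals of type \<open>'k\<close> are those below \<open>\<kappa>\<close>, and an infinite ordinal \<open>\<mu>\<close> among them makes the regular
  cardinal \<open>\<kappa>\<close> uncountable.
\<close>

locale regular_uncountable =
  fixes \<mu> :: "'k::wellorder"
  assumes regular: "infinite_regular_cardinal (ord_rel (UNIV :: 'k set))"
    and infinite_below: "infinite {..<\<mu>}"
begin

lemma Field_ord_rel [simp]: "Field (ord_rel (UNIV :: 'k set)) = UNIV"
  by (auto simp: ord_rel_def Field_def)

lemma Card_order_ord_rel: "Card_order (ord_rel (UNIV :: 'k set))"
  using regular by (simp add: infinite_regular_cardinal_def cinfinite_def)

lemma ex_greater: "\<exists>\<beta>::'k. \<alpha> < \<beta>"
proof -
  have "infinite (UNIV :: 'k set)"
    using regular by (simp add: infinite_regular_cardinal_def cinfinite_def)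
  then obtain \<beta> where "\<alpha> \<noteq> \<beta>" "(\<alpha>, \<beta>) \<in> ord_rel (UNIV :: 'k set)"
    using infinite_Card_order_limit[OF Card_order_ord_rel, of \<alpha>] by auto
  then show ?thesis
    by (auto simp: ord_rel_def intro!: exI[of _ \<beta>])
qed

lemma ex_greater_two: "\<exists>\<gamma>::'k. \<alpha> < \<gamma> \<and> \<beta> < \<gamma>"
  using ex_greater[of "max \<alpha> \<beta>"] by auto

lemma lessThan_small: "|{..<\<beta>::'k}| <o ord_rel (UNIV :: 'k set)"
proof -
  have "underS (ord_rel UNIV) \<beta> = {..<\<beta>}"
    by (auto simp: underS_def ord_rel_def)
  then show ?thesis
    using card_of_underS[OF Card_order_ord_rel, of \<beta>] by simp
qed

lemma small_bounded:
  fixes A :: "'k set"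
  assumes "|A| <o ord_rel (UNIV :: 'k set)"
  shows "\<exists>\<sigma>. \<forall>\<alpha>\<in>A. \<alpha> < \<sigma>"
proof -
  have "\<not> cofinal A (ord_rel (UNIV :: 'k set))"
    using assms regular not_ordLess_ordIso
    by (auto simp: infinite_regular_cardinal_def regularCard_def)
  then obtain \<alpha> where "\<forall>\<beta>\<in>A. \<not> \<alpha> < \<beta>"
    unfolding cofinal_def Field_ord_rel by (auto simp: ord_rel_def less_le)
  moreover obtain \<sigma> where "\<alpha> < \<sigma>"
    using ex_greater by blast
  ultimately show ?thesis
    by (meson leI le_less_trans)
qed

lemma image_lessThan_bounded: "\<exists>\<sigma>. \<forall>i<\<beta>. (f :: 'k \<Rightarrow> 'k) i < \<sigma>"
proof -
  have "|f ` {..<\<beta>}| <o ord_rel (UNIV :: 'k set)"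
    using card_of_image lessThan_small by (rule ordLeq_ordLess_trans)
  from small_bounded[OF this] show ?thesis
    by auto
qed

lemma sequence_bounded: "\<exists>\<sigma>. \<forall>n. (f :: nat \<Rightarrow> 'k) n < \<sigma>"
proof -
  have "|UNIV :: nat set| \<le>o |{..<\<mu>}|"
    using infinite_below by (simp add: infinite_iff_card_of_nat)
  with card_of_image have "|range f| \<le>o |{..<\<mu>}|"
    by (rule ordLeq_transitive)
  then have "|range f| <o ord_rel (UNIV :: 'k set)"
    using lessThan_small by (rule ordLeq_ordLess_trans)
  from small_bounded[OF this] show ?thesis
    by auto
qed

text \<open>
  Sets of this form are the only clubs that have to be produced: the club of a stationarity argument
  can be thinned out to the limit ordinals closed under some function.
\<close>

definition closure_points :: "('k \<Rightarrow> 'k) \<Rightarrow> 'k set" where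
  "closure_points h = {\<delta>. limit_ordinal \<delta> \<and> (\<forall>\<xi><\<delta>. h \<xi> < \<delta>)}"

text \<open>
  Starting from \<open>\<alpha>\<close>, jump \<open>\<omega>\<close> times above the values of \<open>h\<close> on the ordinals below the current one.
  Regularity bounds each of these sets of values, uncountability bounds the jumps.
\<close>

lemma club_closure_points: "club (closure_points h)"
  unfolding club_def
proof (intro conjI allI impI)
  fix \<alpha> :: 'k
  have "\<forall>\<beta>. \<exists>\<sigma>. \<forall>i<\<beta>. h i < \<sigma>"
    using image_lessThan_bounded by blast
  from choice[OF this] obtain H where H: "\<forall>\<beta>. \<forall>i<\<beta>. h i < H \<beta>" ..
  have "\<forall>\<beta>. \<exists>\<gamma>. \<beta> < \<gamma> \<and> H \<beta> < \<gamma>"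
    using ex_greater_two by blast
  from choice[OF this] obtain N where N: "\<forall>\<beta>. \<beta> < N \<beta> \<and> H \<beta> < N \<beta>" ..
  define a where "a n = (N ^^ n) (N \<alpha>)" for n
  have a_Suc: "a n < a (Suc n)" "H (a n) < a (Suc n)" for n
    using N by (auto simp: a_def)
  define \<delta> where "\<delta> = (LEAST \<sigma>. \<forall>n. a n < \<sigma>)"
  have above: "a n < \<delta>" for n
    using LeastI_ex[OF sequence_bounded[of a]] by (auto simp: \<delta>_def)
  have below: "\<exists>n. \<beta> < a n" if "\<beta> < \<delta>" for \<beta>
  proof -
    have "\<exists>n. \<beta> \<le> a n"
      using not_less_Least[of \<beta> "\<lambda>\<sigma>. \<forall>n. a n < \<sigma>"] that by (auto simp: \<delta>_def not_less)
    then show ?thesis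
      using a_Suc(1) by (meson le_less_trans)
  qed
  have "limit_ordinal \<delta>"
    unfolding limit_ordinal_def using above below by blast
  moreover have "h \<xi> < \<delta>" if "\<xi> < \<delta>" for \<xi>
    using below[OF that] H a_Suc(2) above by (meson less_trans)
  moreover have "\<alpha> < \<delta>"
    using spec[OF N, of \<alpha>] above[of 0] by (auto simp: a_def intro: less_trans)
  ultimately show "\<exists>\<beta>\<in>closure_points h. \<alpha> < \<beta>"
    by (auto simp: closure_points_def)
next
  fix \<delta> :: 'k
  assume "limit_ordinal \<delta>" and lim: "\<forall>\<beta><\<delta>. \<exists>\<gamma>\<in>closure_points h. \<beta> < \<gamma> \<and> \<gamma> < \<delta>"
  moreover have "h \<xi> < \<delta>" if "\<xi> < \<delta>" for \<xi>
  proof -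
    obtain \<gamma> where "\<gamma> \<in> closure_points h" "\<xi> < \<gamma>" "\<gamma> < \<delta>"
      using lim \<open>\<xi> < \<delta>\<close> by blast
    then show ?thesis
      by (auto simp: closure_points_def intro: less_trans)
  qed
  ultimately show "\<delta> \<in> closure_points h"
    by (simp add: closure_points_def)
qed

end

section \<open>Diagonalising against as many maps as there are arguments\<close>

text \<open>
  Well-order \<open>F\<close> in order type \<open>|F|\<close>.  When \<open>f\<close> is reached, fewer than \<open>|F| \<le> |P|\<close> values have been
  used, and the injective map \<open>G f\<close> has \<open>|P|\<close> values on \<open>P\<close>.
\<close>

lemma diagonal_choice:
  fixes G :: "'f \<Rightarrow> 'y \<Rightarrow> 'g" and F :: "'f set" and P :: "'y set"
  assumes card: "|F| \<le>o |P|" and inj: "\<And>f. f \<in> F \<Longrightarrow> inj_on (G f) P"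
  obtains y where "\<And>f. f \<in> F \<Longrightarrow> y f \<in> P" and "inj_on (\<lambda>f. G f (y f)) F"
proof -
  define r where "r = |F|"
  let ?r = "r - Id"
  have "wf ?r"
    using card_of_Well_order[of F] by (simp add: r_def well_order_on_def)
  then have "\<exists>y. \<forall>f. f \<in> F \<longrightarrow> y f \<in> P \<and> (\<forall>f'. (f', f) \<in> ?r \<longrightarrow> G f' (y f') \<noteq> G f (y f))"
  proof (rule dependent_wf_choice[where P = "\<lambda>y f z. f \<in> F \<longrightarrow>
        z \<in> P \<and> (\<forall>f'. (f', f) \<in> ?r \<longrightarrow> G f' (y f') \<noteq> G f z)"])
    fix y f
    have "\<exists>z\<in>P. G f z \<notin> (\<lambda>f'. G f' (y f')) ` underS r f" if f: "f \<in> F"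
    proof -
      have "|(\<lambda>f'. G f' (y f')) ` underS r f| \<le>o |underS r f|"
        by (rule card_of_image)
      also have "|underS r f| <o |F|"
        using card_of_underS[OF card_of_Card_order, of f F] f by (simp add: r_def Field_card_of)
      also note card
      also have "|P| \<le>o |G f ` P|"
        using inj[OF f] card_of_ordIso[of P "G f ` P"] ordIso_imp_ordLeq inj_on_imp_bij_betw
        by blast
      finally have "\<not> G f ` P \<subseteq> (\<lambda>f'. G f' (y f')) ` underS r f"
        using card_of_mono1 not_ordLess_ordLeq by blast
      then show ?thesis
        by blast
    qed
    then show "\<exists>z. f \<in> F \<longrightarrow> z \<in> P \<and> (\<forall>f'. (f', f) \<in> ?r \<longrightarrow> G f' (y f') \<noteq> G f z)"
      by (force simp: underS_def image_iff)
  qed simp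
  then obtain y where y: "\<And>f. f \<in> F \<Longrightarrow> y f \<in> P"
      "\<And>f f'. f \<in> F \<Longrightarrow> (f', f) \<in> ?r \<Longrightarrow> G f' (y f') \<noteq> G f (y f)"
    by blast
  have "inj_on (\<lambda>f. G f (y f)) F"
  proof (rule inj_onI)
    fix f f' assume ff': "f \<in> F" "f' \<in> F" "G f (y f) = G f' (y f')"
    show "f = f'"
    proof (rule ccontr)
      assume "f \<noteq> f'"
      moreover have "total_on F r"
        using card_of_card_order_on[of F]
        by (simp add: r_def card_order_on_def well_order_on_def linear_order_on_def)
      ultimately have "(f, f') \<in> ?r \<or> (f', f) \<in> ?r"
        using ff'(1,2) by (auto simp: total_on_def)
      then show False
        using y(2) ff' by metis
    qed
  qed
  with y(1) show thesis
    by (intro that) auto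
qed

text \<open>
  One function \<open>D\<close> that agrees at some point with the partial function \<open>G f y \<mapsto> X f y\<close>, for all \<open>f\<close>
  simultaneously: the arguments chosen for different \<open>f\<close> do not compete.
\<close>

lemma diagonal_function:
  fixes G :: "'f \<Rightarrow> 'y \<Rightarrow> 'g" and X :: "'f \<Rightarrow> 'y \<Rightarrow> 'x"
  assumes "|F| \<le>o |P|"
  shows "\<exists>D. \<forall>f\<in>F. inj_on (G f) P \<longrightarrow> (\<exists>y\<in>P. D (G f y) = X f y)"
proof -
  let ?F = "{f \<in> F. inj_on (G f) P}"
  have "|?F| \<le>o |F|"
    by (rule card_of_mono1) simp
  from this assms have "|?F| \<le>o |P|"
    by (rule ordLeq_transitive)
  then obtain y where y: "\<And>f. f \<in> ?F \<Longrightarrow> y f \<in> P" and inj: "inj_on (\<lambda>f. G f (y f)) ?F"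
    by (rule diagonal_choice[where G = G]) blast+
  define D where "D g = (let f = inv_into ?F (\<lambda>f. G f (y f)) g in X f (y f))" for g
  have "D (G f (y f)) = X f (y f)" if "f \<in> ?F" for f
    using inv_into_f_f[OF inj that] by (simp add: D_def)
  with y show ?thesis
    by (intro exI[of _ D]) blast
qed

section \<open>Guessing causal maps\<close>

text \<open>
  A member of \<open>2\<^sup>\<alpha>\<close> is represented by any total function that extends it; \<open>agree \<alpha>\<close> is equality of
  the represented members.
\<close>

definition agree :: "'k::wellorder \<Rightarrow> ('k \<Rightarrow> bool) \<Rightarrow> ('k \<Rightarrow> bool) \<Rightarrow> bool" where
  "agree \<alpha> y y' \<longleftrightarrow> (\<forall>\<beta><\<alpha>. y \<beta> = y' \<beta>)"

definition causal :: "(('k::wellorder \<Rightarrow> bool) \<Rightarrow> ('k \<Rightarrow> bool)) \<Rightarrow> bool" where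
  "causal G \<longleftrightarrow> (\<forall>\<alpha> y y'. agree \<alpha> y y' \<longrightarrow> agree \<alpha> (G y) (G y'))"

lemma agree_refl [simp]: "agree \<alpha> y y"
  by (simp add: agree_def)

lemma agree_sym: "agree \<alpha> y y' \<Longrightarrow> agree \<alpha> y' y"
  by (simp add: agree_def)

lemma agree_trans: "agree \<alpha> y y' \<Longrightarrow> agree \<alpha> y' y'' \<Longrightarrow> agree \<alpha> y y''"
  by (simp add: agree_def)

lemma agree_mono: "agree \<beta> y y' \<Longrightarrow> \<alpha> \<le> \<beta> \<Longrightarrow> agree \<alpha> y y'"
  by (auto simp: agree_def)

lemma causalD: "causal G \<Longrightarrow> agree \<alpha> y y' \<Longrightarrow> agree \<alpha> (G y) (G y')"
  by (simp add: causal_def)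

context regular_uncountable
begin

text \<open>
  Triples of members of \<open>2\<^sup>\<alpha>\<close> are members of \<open>8\<^sup>\<alpha>\<close>, hence coded by the sequences counted in the
  assumption.
\<close>

lemma bounded_sequences_enumeration:
  assumes card: "|seqs :: ('k \<rightharpoonup> 'k) set| =o ord_rel (UNIV :: 'k set)"
  shows "\<exists>(l :: 'k \<Rightarrow> 'k) Y g x. \<forall>\<alpha> y' g' x'. \<exists>\<xi>.
    l \<xi> = \<alpha> \<and> agree \<alpha> (Y \<xi>) y' \<and> agree \<alpha> (g \<xi>) g' \<and> agree \<alpha> (x \<xi>) x'"
proof -
  have "|UNIV :: 'k set| =o ord_rel (UNIV :: 'k set)"
    using card_of_Field_ordIso[OF Card_order_ord_rel] by simp
  then have "|UNIV :: 'k set| =o |seqs :: ('k \<rightharpoonup> 'k) set|"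
    using card ordIso_symmetric ordIso_transitive by blast
  then obtain u :: "'k \<Rightarrow> 'k \<rightharpoonup> 'k" where u: "bij_betw u UNIV seqs"
    unfolding card_of_ordIso[symmetric] by blast
  have "infinite (UNIV :: 'k set)"
    using regular by (simp add: infinite_regular_cardinal_def cinfinite_def)
  then obtain A :: "'k set" where "finite A" "card A = card (UNIV :: (bool \<times> bool \<times> bool) set)"
    using infinite_arbitrarily_large by blast
  then obtain j :: "bool \<times> bool \<times> bool \<Rightarrow> 'k" where "bij_betw j UNIV A"
    using finite_same_card_bij[OF finite_UNIV] by metis
  then have j: "inj j"
    by (auto simp: bij_betw_def)
  define w where "w \<xi> \<beta> = inv j (the (u \<xi> \<beta>))" for \<xi> \<beta>
  define l where "l \<xi> = (THE \<alpha>. dom (u \<xi>) = {..<\<alpha>})" for \<xi>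
  have "\<exists>\<xi>. l \<xi> = \<alpha> \<and> (\<forall>\<beta><\<alpha>. w \<xi> \<beta> = s \<beta>)" for \<alpha> and s :: "'k \<Rightarrow> bool \<times> bool \<times> bool"
  proof -
    define t where "t \<beta> = (if \<beta> < \<alpha> then Some (j (s \<beta>)) else None)" for \<beta>
    have dom: "dom t = {..<\<alpha>}"
      by (auto simp: t_def split: if_splits)
    then have "t \<in> seqs"
      by (auto simp: seqs_def)
    then obtain \<xi> where \<xi>: "u \<xi> = t"
      using u unfolding bij_betw_def by (metis imageE)
    have "l \<xi> = \<alpha>"
      unfolding l_def \<xi> dom by (intro the_equality) (auto simp: lessThan_eq_iff)
    moreover have "w \<xi> \<beta> = s \<beta>" if "\<beta> < \<alpha>" for \<beta>
      using that j by (simp add: w_def \<xi> t_def)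
    ultimately show ?thesis
      by blast
  qed
  note w = this
  have "\<exists>\<xi>. l \<xi> = \<alpha> \<and> agree \<alpha> (\<lambda>\<beta>. fst (w \<xi> \<beta>)) y' \<and> agree \<alpha> (\<lambda>\<beta>. fst (snd (w \<xi> \<beta>))) g' \<and>
      agree \<alpha> (\<lambda>\<beta>. snd (snd (w \<xi> \<beta>))) x'" for \<alpha> y' g' x'
    using w[of \<alpha> "\<lambda>\<beta>. (y' \<beta>, g' \<beta>, x' \<beta>)"] by (auto simp: agree_def)
  then show ?thesis
    by (intro exI[of _ l] exI[of _ "\<lambda>\<xi> \<beta>. fst (w \<xi> \<beta>)"] exI[of _ "\<lambda>\<xi> \<beta>. fst (snd (w \<xi> \<beta>))"]
        exI[of _ "\<lambda>\<xi> \<beta>. snd (snd (w \<xi> \<beta>))"] allI)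
qed

text \<open>
  The function \<open>c\<close> controls how far \<open>G\<close> lags behind: two branches that split at \<open>\<alpha>\<close> are told apart by \<open>G\<close>
  at or below \<open>c y \<alpha>\<close>.  The guess is required at all closure points of some \<open>h\<close>, and for a branch on
  which \<open>c\<close> does not lead out of \<open>\<delta>\<close>, so that at \<open>\<delta>\<close> the lag is gone.
\<close>

definition causal_guessing :: "('k \<Rightarrow> ('k \<Rightarrow> bool) \<Rightarrow> 'k \<Rightarrow> bool) \<Rightarrow> bool" where
  "causal_guessing D \<longleftrightarrow>
     (\<forall>\<delta> g g'. agree \<delta> g g' \<longrightarrow> D \<delta> g = D \<delta> g') \<and>
     (\<forall>G X c. causal G \<longrightarrow> causal X \<longrightarrow> (\<forall>y y' \<alpha>. agree \<alpha> y y' \<longrightarrow> c y \<alpha> = c y' \<alpha>) \<longrightarrow>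
        (\<forall>y y' \<alpha>. agree \<alpha> y y' \<longrightarrow> y \<alpha> \<noteq> y' \<alpha> \<longrightarrow> (\<exists>\<beta>\<le>c y \<alpha>. G y \<beta> \<noteq> G y' \<beta>)) \<longrightarrow>
        (\<exists>h. \<forall>\<delta>\<in>closure_points h. \<exists>y. agree \<delta> (D \<delta> (G y)) (X y) \<and> (\<forall>\<alpha><\<delta>. c y \<alpha> < \<delta>)))"

lemma causal_guessing_agree: "causal_guessing D \<Longrightarrow> agree \<delta> g g' \<Longrightarrow> D \<delta> g = D \<delta> g'"
  unfolding causal_guessing_def by blast

lemma causal_guessingD:
  assumes "causal_guessing D" "causal G" "causal X" "\<And>y y' \<alpha>. agree \<alpha> y y' \<Longrightarrow> c y \<alpha> = c y' \<alpha>"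
    and "\<And>y y' \<alpha>. agree \<alpha> y y' \<Longrightarrow> y \<alpha> \<noteq> y' \<alpha> \<Longrightarrow> \<exists>\<beta>\<le>c y \<alpha>. G y \<beta> \<noteq> G y' \<beta>"
  shows "\<exists>h. \<forall>\<delta>\<in>closure_points h. \<exists>y. agree \<delta> (D \<delta> (G y)) (X y) \<and> (\<forall>\<alpha><\<delta>. c y \<alpha> < \<delta>)"
  using conjunct2[OF assms(1)[unfolded causal_guessing_def], rule_format, OF assms(2-5)] by simp

text \<open>
  The index \<open>\<xi>\<close> stands for the assertion that \<open>G\<close> and \<open>X\<close> map \<open>Y \<xi>\<close> to \<open>g \<xi>\<close> and \<open>x \<xi>\<close>, all three cut
  off at \<open>l \<xi>\<close>.  The set \<open>f\<close> of the true assertions codes the pair \<open>(G, X)\<close>, and for suitable \<open>\<delta>\<close> the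
  assertions with index below \<open>\<delta>\<close> suffice to compute \<open>G y\<close> and \<open>X y\<close> below \<open>\<delta>\<close> for all \<open>y\<close> in \<open>P \<delta>\<close>.
\<close>

theorem ex_causal_guessing:
  assumes card: "|seqs :: ('k \<rightharpoonup> 'k) set| =o ord_rel (UNIV :: 'k set)"
  shows "\<exists>D :: 'k \<Rightarrow> ('k \<Rightarrow> bool) \<Rightarrow> 'k \<Rightarrow> bool. causal_guessing D"
proof -
  obtain l :: "'k \<Rightarrow> 'k" and Y g x where enum: "\<And>\<alpha> y' g' x'. \<exists>\<xi>.
      l \<xi> = \<alpha> \<and> agree \<alpha> (Y \<xi>) y' \<and> agree \<alpha> (g \<xi>) g' \<and> agree \<alpha> (x \<xi>) x'"
    using bounded_sequences_enumeration[OF card] by auto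
  \<comment> \<open>Members of \<open>2\<^sup>\<delta>\<close> are made canonical by the value \<open>False\<close> from \<open>\<delta>\<close> on.\<close>
  define P where "P \<delta> = {y. (\<forall>\<alpha><\<delta>. \<exists>\<xi><\<delta>. l \<xi> = \<alpha> \<and> agree \<alpha> (Y \<xi>) y) \<and> (\<forall>\<beta>\<ge>\<delta>. \<not> y \<beta>)}" for \<delta>
  have P_D: "\<exists>\<xi><\<delta>. l \<xi> = \<alpha> \<and> agree \<alpha> (Y \<xi>) y" if "y \<in> P \<delta>" "\<alpha> < \<delta>" for y \<alpha> \<delta>
    using that unfolding P_def by blast
  \<comment> \<open>The map decoded from the assertions in \<open>f\<close>; it is used with \<open>s = g\<close> and \<open>s = x\<close>.\<close>
  define dec where "dec \<delta> s f y \<beta> \<longleftrightarrow> \<beta> < \<delta> \<and> (\<exists>\<xi><\<delta>. f \<xi> \<and> agree (l \<xi>) (Y \<xi>) y \<and> \<beta> < l \<xi> \<and> s \<xi> \<beta>)"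
    for \<delta> f y \<beta> and s :: "'k \<Rightarrow> 'k \<Rightarrow> bool"
  have "\<forall>\<delta>. \<exists>E. \<forall>f\<in>P \<delta>. inj_on (dec \<delta> g f) (P \<delta>) \<longrightarrow> (\<exists>y\<in>P \<delta>. E (dec \<delta> g f y) = dec \<delta> x f y)"
    by (intro allI diagonal_function card_of_mono1 order_refl)
  from choice[OF this] obtain E where E: "\<forall>\<delta>. \<forall>f\<in>P \<delta>.
      inj_on (dec \<delta> g f) (P \<delta>) \<longrightarrow> (\<exists>y\<in>P \<delta>. E \<delta> (dec \<delta> g f y) = dec \<delta> x f y)" ..
  define D where "D \<delta> \<gamma> = E \<delta> (\<lambda>\<beta>. \<beta> < \<delta> \<and> \<gamma> \<beta>)" for \<delta> \<gamma>
  have "causal_guessing D"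
    unfolding causal_guessing_def
  proof (intro conjI allI impI)
    show "D \<delta> \<gamma> = D \<delta> \<gamma>'" if "agree \<delta> \<gamma> \<gamma>'" for \<delta> \<gamma> \<gamma>'
      using that unfolding D_def agree_def by (metis (mono_tags, lifting))
  next
    fix G X :: "('k \<Rightarrow> bool) \<Rightarrow> ('k \<Rightarrow> bool)" and c
    assume G: "causal G" and X: "causal X"
      and c: "\<forall>y y' \<alpha>. agree \<alpha> y y' \<longrightarrow> c y \<alpha> = c y' \<alpha>"
      and split: "\<forall>y y' \<alpha>. agree \<alpha> y y' \<longrightarrow> y \<alpha> \<noteq> y' \<alpha> \<longrightarrow> (\<exists>\<beta>\<le>c y \<alpha>. G y \<beta> \<noteq> G y' \<beta>)"
    define f where "f \<xi> \<longleftrightarrow> agree (l \<xi>) (g \<xi>) (G (Y \<xi>)) \<and> agree (l \<xi>) (x \<xi>) (X (Y \<xi>))" for \<xi>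
    \<comment> \<open>\<open>h\<^sub>1\<close> finds the true assertion about \<open>Y \<xi>\<close>, \<open>h\<^sub>2\<close> the initial segments of \<open>f\<close> in the enumeration.\<close>
    have "\<forall>\<xi>. \<exists>\<eta>. l \<eta> = l \<xi> \<and> agree (l \<xi>) (Y \<eta>) (Y \<xi>) \<and> agree (l \<xi>) (g \<eta>) (G (Y \<xi>)) \<and>
        agree (l \<xi>) (x \<eta>) (X (Y \<xi>))"
      using enum by blast
    from choice[OF this] obtain h\<^sub>1 where h\<^sub>1: "\<forall>\<xi>. l (h\<^sub>1 \<xi>) = l \<xi> \<and> agree (l \<xi>) (Y (h\<^sub>1 \<xi>)) (Y \<xi>) \<and>
        agree (l \<xi>) (g (h\<^sub>1 \<xi>)) (G (Y \<xi>)) \<and> agree (l \<xi>) (x (h\<^sub>1 \<xi>)) (X (Y \<xi>))" ..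
    have f_h\<^sub>1: "f (h\<^sub>1 \<xi>)" for \<xi>
      unfolding f_def using spec[OF h\<^sub>1, of \<xi>] causalD[OF G] causalD[OF X] by (metis agree_sym agree_trans)
    have "\<forall>\<alpha>. \<exists>\<eta>. l \<eta> = \<alpha> \<and> agree \<alpha> (Y \<eta>) f"
      using enum by blast
    from choice[OF this] obtain h\<^sub>2 where h\<^sub>2: "\<forall>\<alpha>. l (h\<^sub>2 \<alpha>) = \<alpha> \<and> agree \<alpha> (Y (h\<^sub>2 \<alpha>)) f" ..
    define h where "h \<xi> = max (max (h\<^sub>1 \<xi>) (h\<^sub>2 \<xi>)) (c (Y \<xi>) (l \<xi>))" for \<xi>
    show "\<exists>h. \<forall>\<delta>\<in>closure_points h. \<exists>y. agree \<delta> (D \<delta> (G y)) (X y) \<and> (\<forall>\<alpha><\<delta>. c y \<alpha> < \<delta>)"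
    proof (rule exI[of _ h], rule ballI)
      fix \<delta> assume "\<delta> \<in> closure_points h"
      then have lim: "limit_ordinal \<delta>" and clos: "\<And>\<xi>. \<xi> < \<delta> \<Longrightarrow> h\<^sub>1 \<xi> < \<delta>" "\<And>\<xi>. \<xi> < \<delta> \<Longrightarrow> h\<^sub>2 \<xi> < \<delta>"
          "\<And>\<xi>. \<xi> < \<delta> \<Longrightarrow> c (Y \<xi>) (l \<xi>) < \<delta>"
        by (auto simp: closure_points_def h_def)
      define f' where "f' \<xi> \<longleftrightarrow> \<xi> < \<delta> \<and> f \<xi>" for \<xi>
      have f': "f' \<in> P \<delta>"
      proof -
        have "agree \<alpha> (Y (h\<^sub>2 \<alpha>)) f'" if "\<alpha> < \<delta>" for \<alpha>
          using spec[OF h\<^sub>2, of \<alpha>] that by (auto simp: agree_def f'_def)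
        then show ?thesis
          using h\<^sub>2 clos(2) by (auto simp: P_def f'_def not_less intro!: exI[of _ "h\<^sub>2 _"])
      qed
      have dec: "dec \<delta> s f' y = (\<lambda>\<beta>. \<beta> < \<delta> \<and> Z y \<beta>)"
        if y: "y \<in> P \<delta>" and Z: "causal Z" and s: "\<And>\<xi>. f \<xi> \<Longrightarrow> agree (l \<xi>) (s \<xi>) (Z (Y \<xi>))" for s Z y
      proof (rule ext, rule iffI)
        fix \<beta> assume "dec \<delta> s f' y \<beta>"
        then obtain \<xi> where \<xi>: "\<beta> < \<delta>" "f \<xi>" "agree (l \<xi>) (Y \<xi>) y" "\<beta> < l \<xi>" "s \<xi> \<beta>"
          by (auto simp: dec_def f'_def)
        then show "\<beta> < \<delta> \<and> Z y \<beta>"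
          using s[OF \<open>f \<xi>\<close>] causalD[OF Z \<xi>(3)] by (auto simp: agree_def)
      next
        fix \<beta> assume \<beta>: "\<beta> < \<delta> \<and> Z y \<beta>"
        then obtain \<alpha> where \<alpha>: "\<beta> < \<alpha>" "\<alpha> < \<delta>"
          using lim by (auto simp: limit_ordinal_def)
        then obtain \<xi> where \<xi>: "\<xi> < \<delta>" "l \<xi> = \<alpha>" "agree \<alpha> (Y \<xi>) y"
          using P_D[OF y] by blast
        have agr: "agree \<alpha> (Y (h\<^sub>1 \<xi>)) y"
          using spec[OF h\<^sub>1, of \<xi>] \<xi> by (auto intro: agree_trans)
        have "s (h\<^sub>1 \<xi>) \<beta>"
          using s[OF f_h\<^sub>1[of \<xi>]] causalD[OF Z agr] spec[OF h\<^sub>1, of \<xi>] \<xi> \<alpha> \<beta> by (auto simp: agree_def)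
        then show "dec \<delta> s f' y \<beta>"
          unfolding dec_def f'_def using \<beta> f_h\<^sub>1 clos(1)[OF \<xi>(1)] spec[OF h\<^sub>1, of \<xi>] \<xi>(2) agr \<alpha>(1) by auto
      qed
      have c_less: "c y \<alpha> < \<delta>" if y: "y \<in> P \<delta>" "\<alpha> < \<delta>" for y \<alpha>
      proof -
        obtain \<xi> where "\<xi> < \<delta>" "l \<xi> = \<alpha>" "agree \<alpha> (Y \<xi>) y"
          using P_D[OF y] by blast
        then show ?thesis
          using clos(3)[of \<xi>] c by simp
      qed
      have dec_g: "dec \<delta> g f' y = (\<lambda>\<beta>. \<beta> < \<delta> \<and> G y \<beta>)" if "y \<in> P \<delta>" for y
        using that G by (rule dec) (simp add: f_def)
      have dec_x: "dec \<delta> x f' y = (\<lambda>\<beta>. \<beta> < \<delta> \<and> X y \<beta>)" if "y \<in> P \<delta>" for y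
        using that X by (rule dec) (simp add: f_def)
      have "inj_on (dec \<delta> g f') (P \<delta>)"
      proof (rule inj_onI, rule ccontr)
        fix y y' assume yy': "y \<in> P \<delta>" "y' \<in> P \<delta>" "dec \<delta> g f' y = dec \<delta> g f' y'" "y \<noteq> y'"
        define \<alpha> where "\<alpha> = (LEAST \<alpha>. y \<alpha> \<noteq> y' \<alpha>)"
        have "\<exists>\<alpha>. y \<alpha> \<noteq> y' \<alpha>"
          using \<open>y \<noteq> y'\<close> by (simp add: fun_eq_iff)
        then have differ: "y \<alpha> \<noteq> y' \<alpha>"
          unfolding \<alpha>_def by (rule LeastI_ex)
        have "agree \<alpha> y y'"
          unfolding agree_def \<alpha>_def by (auto dest: not_less_Least)
        with differ obtain \<beta> where \<beta>: "\<beta> \<le> c y \<alpha>" "G y \<beta> \<noteq> G y' \<beta>"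
          using split by blast
        have "\<alpha> < \<delta>"
          using differ yy'(1,2) by (cases "\<alpha> < \<delta>") (simp_all add: P_def not_less)
        then have "\<beta> < \<delta>"
          using c_less[OF yy'(1)] \<beta>(1) by (meson le_less_trans)
        moreover have "(\<lambda>\<beta>. \<beta> < \<delta> \<and> G y \<beta>) = (\<lambda>\<beta>. \<beta> < \<delta> \<and> G y' \<beta>)"
          using yy'(3) dec_g[OF yy'(1)] dec_g[OF yy'(2)] by simp
        ultimately show False
          using \<beta>(2) by (auto dest: fun_cong[of _ _ \<beta>])
      qed
      then obtain y where y: "y \<in> P \<delta>" "E \<delta> (dec \<delta> g f' y) = dec \<delta> x f' y"
        using E f' by blast
      then have "D \<delta> (G y) = (\<lambda>\<beta>. \<beta> < \<delta> \<and> X y \<beta>)"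
        by (simp add: D_def dec_g dec_x)
      then show "\<exists>y. agree \<delta> (D \<delta> (G y)) (X y) \<and> (\<forall>\<alpha><\<delta>. c y \<alpha> < \<delta>)"
        using c_less[OF y(1)] by (intro exI[of _ y]) (auto simp: agree_def)
    qed
  qed
  then show ?thesis
    by (rule exI[of _ D])
qed

end

section \<open>The forcing language\<close>

lemma f_imp_iff: "f_imp R \<phi> \<psi> p \<longleftrightarrow> (\<forall>q. (p, q) \<in> R \<longrightarrow> \<phi> q \<longrightarrow> (\<exists>r. (q, r) \<in> R \<and> \<psi> r))"
  by (auto simp: f_imp_def f_not_def f_and_def)

lemma f_bex_iff: "f_bex R A \<phi> p \<longleftrightarrow> (\<forall>q. (p, q) \<in> R \<longrightarrow> (\<exists>a\<in>A. \<exists>r. (q, r) \<in> R \<and> \<phi> a r))"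
  by (auto simp: f_bex_def f_not_def f_ball_def)

lemma f_ex_namesI:
  assumes "\<And>q. (p, q) \<in> R \<Longrightarrow> (q, q) \<in> R" and "\<And>q. (p, q) \<in> R \<Longrightarrow> \<phi> \<tau> q"
  shows "f_ex_names R \<phi> p"
  using assms unfolding f_ex_names_def f_all_names_def f_not_def by blast

definition persistent :: "'p rel \<Rightarrow> 'p sentence \<Rightarrow> bool" where
  "persistent R \<phi> \<longleftrightarrow> (\<forall>p q. (p, q) \<in> R \<longrightarrow> \<phi> p \<longrightarrow> \<phi> q)"

lemma persistentD: "persistent R \<phi> \<Longrightarrow> (p, q) \<in> R \<Longrightarrow> \<phi> p \<Longrightarrow> \<phi> q"
  by (auto simp: persistent_def)

lemma persistent_f_not: "trans R \<Longrightarrow> persistent R (f_not R \<phi>)"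
  unfolding persistent_def f_not_def by (meson transD)

lemma persistent_f_mem: "trans R \<Longrightarrow> persistent R (f_mem R a \<tau>)"
  unfolding persistent_def f_mem_def by (meson transD)

lemma persistent_f_and: "persistent R \<phi> \<Longrightarrow> persistent R \<psi> \<Longrightarrow> persistent R (f_and \<phi> \<psi>)"
  unfolding persistent_def f_and_def by blast

lemma persistent_f_ball: "(\<And>a. a \<in> A \<Longrightarrow> persistent R (\<phi> a)) \<Longrightarrow> persistent R (f_ball A \<phi>)"
  unfolding persistent_def f_ball_def by blast

lemma persistent_f_imp: "trans R \<Longrightarrow> persistent R (f_imp R \<phi> \<psi>)"
  unfolding f_imp_def by (rule persistent_f_not)

lemma persistent_f_bex: "trans R \<Longrightarrow> persistent R (f_bex R A \<phi>)"
  unfolding f_bex_def by (rule persistent_f_not)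

lemmas persistent_intros = persistent_f_not persistent_f_mem persistent_f_and persistent_f_ball
  persistent_f_imp persistent_f_bex

lemma persistent_f_function: "trans R \<Longrightarrow> persistent R (f_function R A B \<tau>)"
  unfolding f_function_def by (intro persistent_intros)

lemma persistent_f_club: "trans R \<Longrightarrow> persistent R (f_club R C)"
  unfolding f_club_def by (intro persistent_intros)

lemma f_memI: "trans R \<Longrightarrow> (a, s) \<in> \<tau> \<Longrightarrow> (s, p) \<in> R \<Longrightarrow> \<forall>q. (p, q) \<in> R \<longrightarrow> (q, q) \<in> R \<Longrightarrow> f_mem R a \<tau> p"
  unfolding f_mem_def by (meson transD)

lemma f_memD: "f_mem R a \<tau> p \<Longrightarrow> (p, q) \<in> R \<Longrightarrow> \<exists>r s. (q, r) \<in> R \<and> (a, s) \<in> \<tau> \<and> (s, r) \<in> R"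
  unfolding f_mem_def by blast

lemma f_functionD_value:
  assumes "f_function R A B \<tau> p" "(p, p) \<in> R" "a \<in> A"
  shows "\<exists>b\<in>B. \<exists>q. (p, q) \<in> R \<and> f_mem R (a, b) \<tau> q"
  using assms unfolding f_function_def f_and_def f_ball_def f_bex_iff by blast

lemma f_functionD_unique:
  assumes "f_function R A B \<tau> p" "(p, p) \<in> R" "a \<in> A" "b \<in> B" "c \<in> B"
    and "f_mem R (a, b) \<tau> p" "f_mem R (a, c) \<tau> p"
  shows "b = c"
  using assms unfolding f_function_def f_and_def f_ball_def f_not_def by blast

lemma f_clubD_unbounded:
  assumes "f_club R C p" "(p, p) \<in> R"
  shows "\<exists>\<beta>>\<alpha>. \<exists>q. (p, q) \<in> R \<and> f_mem R \<beta> C q"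
  using assms unfolding f_club_def f_and_def f_ball_def f_bex_iff by blast

text \<open>
  Only a strengthening is obtained, since implication is the classical abbreviation.
\<close>

lemma f_clubD_closed:
  assumes "f_club R C p" "(p, p) \<in> R" "trans R" "limit_ordinal \<delta>"
    and lim: "\<And>\<beta>. \<beta> < \<delta> \<Longrightarrow> \<exists>\<gamma>>\<beta>. \<gamma> < \<delta> \<and> f_mem R \<gamma> C p" and refl: "\<And>q. (p, q) \<in> R \<Longrightarrow> (q, q) \<in> R"
  shows "\<exists>q. (p, q) \<in> R \<and> f_mem R \<delta> C q"
proof -
  have "f_ball {..<\<delta>} (\<lambda>\<beta>. f_bex R {\<beta><..<\<delta>} (\<lambda>\<gamma>. f_mem R \<gamma> C)) p"
    unfolding f_ball_def f_bex_iff
  proof (intro ballI allI impI)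
    fix \<beta> q assume "\<beta> \<in> {..<\<delta>}" "(p, q) \<in> R"
    then obtain \<gamma> where "\<beta> < \<gamma>" "\<gamma> < \<delta>" "f_mem R \<gamma> C p"
      using lim by auto
    then show "\<exists>\<gamma>\<in>{\<beta><..<\<delta>}. \<exists>r. (q, r) \<in> R \<and> f_mem R \<gamma> C r"
      using persistentD[OF persistent_f_mem[OF \<open>trans R\<close>] \<open>(p, q) \<in> R\<close>] refl[OF \<open>(p, q) \<in> R\<close>]
      by (intro bexI[of _ \<gamma>] exI[of _ q]) auto
  qed
  then show ?thesis
    using assms(1,2,4) unfolding f_club_def f_and_def f_ball_def[of "Collect limit_ordinal"] f_imp_iff by blast
qed

section \<open>Forcing the diamond along a tree of conditions\<close>

text \<open>
  The condition reached at \<open>\<beta>\<close> when following the branch \<open>y\<close>: \<open>St p \<alpha> i\<close> is the successor of \<open>p\<close> at step \<open>\<alpha>\<close>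
  in direction \<open>i\<close>, and \<open>U\<close> chooses an upper bound of a set of conditions.  Bounding all earlier
  successors treats zero, successors and limits uniformly, and as \<open>U\<close> and \<open>St\<close> are fixed, branches that
  agree below \<open>\<beta>\<close> reach the same condition.
\<close>

function run :: "('p set \<Rightarrow> 'p) \<Rightarrow> ('p \<Rightarrow> 'k::wellorder \<Rightarrow> bool \<Rightarrow> 'p) \<Rightarrow> ('k \<Rightarrow> bool) \<Rightarrow> 'k \<Rightarrow> 'p"
  where "run U St y \<beta> = U ((\<lambda>\<alpha>. St (run U St y \<alpha>) \<alpha> (y \<alpha>)) ` {..<\<beta>})"
  by pat_completeness auto
termination
  by (relation "inv_image {(\<alpha>, \<beta>). \<alpha> < \<beta>} (\<lambda>(U, St, y, \<beta>). \<beta>)") (auto intro: wf)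

declare run.simps [simp del]

lemma run_agree: "agree \<beta> y y' \<Longrightarrow> run U St y \<beta> = run U St y' \<beta>"
proof (induction \<beta> rule: less_induct)
  case (less \<beta>)
  have "St (run U St y \<alpha>) \<alpha> (y \<alpha>) = St (run U St y' \<alpha>) \<alpha> (y' \<alpha>)" if "\<alpha> < \<beta>" for \<alpha>
    using less.IH[OF that agree_mono[OF less.prems]] less.prems that by (simp add: agree_def)
  then show ?case
    unfolding run.simps[of U St _ \<beta>] by (intro arg_cong[of _ _ U] image_cong) auto
qed

text \<open>
  \<open>decides p \<alpha> b\<close> means that \<open>p\<close> determines the value at \<open>\<alpha>\<close> of the generic function to be \<open>b\<close>.  It is left
  abstract because Silver conditions are parts of this function, whereas Sacks conditions are trees
  with the function as a branch.
\<close>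

locale stem_forcing = regular_uncountable \<mu> for \<mu> :: "'k::wellorder" +
  fixes R :: "'p rel" and decides :: "'p \<Rightarrow> 'k \<Rightarrow> bool \<Rightarrow> bool"
  assumes refl: "p \<in> Field R \<Longrightarrow> (p, p) \<in> R"
    and trans: "trans R"
    and decides_mono: "(p, q) \<in> R \<Longrightarrow> decides p \<alpha> b \<Longrightarrow> decides q \<alpha> b"
    and decides_unique: "p \<in> Field R \<Longrightarrow> decides p \<alpha> b \<Longrightarrow> decides p \<alpha> c \<Longrightarrow> b = c"
    and decide_below: "p \<in> Field R \<Longrightarrow> \<exists>q. (p, q) \<in> R \<and> (\<forall>\<beta><\<alpha>. \<exists>b. decides q \<beta> b)"
    and decide_both: "p \<in> Field R \<Longrightarrow>
      \<exists>\<alpha> q q'. (p, q) \<in> R \<and> decides q \<alpha> True \<and> (p, q') \<in> R \<and> decides q' \<alpha> False"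
    and closed: "\<alpha> < \<beta> \<Longrightarrow> (\<And>i j. i \<le> j \<Longrightarrow> j < \<beta> \<Longrightarrow> (f i, f j) \<in> R) \<Longrightarrow>
      \<exists>q. \<forall>i<\<beta>. (f i, q) \<in> R"
begin

lemma transR: "(p, q) \<in> R \<Longrightarrow> (q, r) \<in> R \<Longrightarrow> (p, r) \<in> R"
  using trans by (rule transD)

lemma refl_right: "(p, q) \<in> R \<Longrightarrow> (q, q) \<in> R"
  using refl by (auto simp: Field_def)

lemma FieldI_right: "(p, q) \<in> R \<Longrightarrow> q \<in> Field R"
  by (auto simp: Field_def)

text \<open>
  The name of the sequence \<open>d\<^sub>\<delta> = D\<^sub>\<delta>(G \<restriction> \<delta>)\<close>: a condition contributes the values of \<open>d\<^sub>\<delta>\<close> as soon as it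
  decides \<open>G \<restriction> \<delta>\<close>.
\<close>

definition guess_name :: "('k \<Rightarrow> ('k \<Rightarrow> bool) \<Rightarrow> 'k \<Rightarrow> bool) \<Rightarrow> 'k set \<Rightarrow> (('k \<times> 'k) \<times> bool, 'p) name" where
  "guess_name D S = {(((\<delta>, \<alpha>), b), s). \<delta> \<in> S \<and> \<alpha> < \<delta> \<and> s \<in> Field R \<and>
     (\<exists>g. (\<forall>\<beta><\<delta>. decides s \<beta> (g \<beta>)) \<and> b = D \<delta> g \<alpha>)}"

lemma f_mem_guess_name:
  assumes "p \<in> Field R" "\<delta> \<in> S" "\<alpha> < \<delta>" "\<forall>\<beta><\<delta>. decides p \<beta> (g \<beta>)"
  shows "f_mem R ((\<delta>, \<alpha>), D \<delta> g \<alpha>) (guess_name D S) p"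
  using assms refl refl_right trans by (intro f_memI[of _ _ p]) (auto simp: guess_name_def)

lemma f_function_guess_name:
  assumes p: "p \<in> Field R" and D: "causal_guessing D"
  shows "f_function R (SIGMA \<delta>:S. {..<\<delta>}) UNIV (guess_name D S) p"
proof -
  have "\<exists>b r. (q, r) \<in> R \<and> f_mem R ((\<delta>, \<alpha>), b) (guess_name D S) r"
    if q: "(p, q) \<in> R" and \<delta>: "\<delta> \<in> S" "\<alpha> < \<delta>" for q \<delta> \<alpha>
  proof -
    obtain r where r: "(q, r) \<in> R" "\<forall>\<beta><\<delta>. \<exists>b. decides r \<beta> b"
      using decide_below FieldI_right[OF q] by blast
    then obtain g where "\<forall>\<beta><\<delta>. decides r \<beta> (g \<beta>)"
      by metis
    then show ?thesis
      using f_mem_guess_name[OF FieldI_right[OF r(1)] \<delta>] r(1) by blast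
  qed
  moreover have "b = c" if q: "(p, q) \<in> R" and b: "f_mem R ((\<delta>, \<alpha>), b) (guess_name D S) q"
    and c: "f_mem R ((\<delta>, \<alpha>), c) (guess_name D S) q" for q \<delta> \<alpha> b c
  proof -
    obtain r s where r: "(q, r) \<in> R" "(s, r) \<in> R" and s: "(((\<delta>, \<alpha>), b), s) \<in> guess_name D S"
      using f_memD[OF b refl_right[OF q]] by blast
    obtain r' s' where r': "(r, r') \<in> R" "(s', r') \<in> R" and s': "(((\<delta>, \<alpha>), c), s') \<in> guess_name D S"
      using f_memD[OF c r(1)] by blast
    obtain g where g: "\<forall>\<beta><\<delta>. decides s \<beta> (g \<beta>)" "b = D \<delta> g \<alpha>"
      using s by (auto simp: guess_name_def)
    obtain g' where g': "\<forall>\<beta><\<delta>. decides s' \<beta> (g' \<beta>)" "c = D \<delta> g' \<alpha>"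
      using s' by (auto simp: guess_name_def)
    have "g \<beta> = g' \<beta>" if "\<beta> < \<delta>" for \<beta>
      using decides_unique[OF FieldI_right[OF r'(1)]] decides_mono[OF transR[OF r(2) r'(1)]]
        decides_mono[OF r'(2)] g(1) g'(1) that by blast
    then have "D \<delta> g = D \<delta> g'"
      by (intro causal_guessing_agree[OF D]) (simp add: agree_def)
    with g(2) g'(2) show ?thesis
      by simp
  qed
  moreover have "z \<in> (SIGMA \<delta>:S. {..<\<delta>}) \<times> UNIV" if q: "(p, q) \<in> R" and z: "f_mem R z (guess_name D S) q" for q z
    using f_memD[OF z refl_right[OF q]] by (auto simp: guess_name_def)
  ultimately show ?thesis
    unfolding f_function_def f_and_def f_ball_def f_not_def f_bex_iff by blast
qed

text \<open>
  The tree of conditions is built above \<open>q\<close>, and the causal maps given by its branches are submitted to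
  \<open>D\<close>.  The bound \<open>c\<close> lies above the place where the two directions at a node disagree and above the
  ordinals forced into \<open>C\<close> there.  So if \<open>c y \<alpha> < \<delta>\<close> for all \<open>\<alpha> < \<delta>\<close>, then the condition that \<open>y\<close>
  reaches at \<open>\<delta>\<close> forces \<open>C\<close> to be unbounded in \<open>\<delta>\<close>.
\<close>

theorem ex_capturing_condition:
  fixes x :: "('k \<times> bool, 'p) name" and C :: "('k, 'p) name"
  assumes S: "stationary S" and D: "causal_guessing D"
    and q: "q \<in> Field R" and x: "f_function R UNIV UNIV x q" and C: "f_club R C q"
  shows "\<exists>\<delta>\<in>S. \<exists>r g. (q, r) \<in> R \<and> f_mem R \<delta> C r \<and> (\<forall>\<beta><\<delta>. decides r \<beta> (g \<beta>)) \<and>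
    (\<forall>\<alpha><\<delta>. f_mem R (\<alpha>, D \<delta> g \<alpha>) x r)"
proof -
  note mem_mono = persistentD[OF persistent_f_mem[OF trans]]
  \<comment> \<open>What a condition has to settle at step \<open>\<alpha>\<close>.\<close>
  define good where "good \<alpha> \<gamma> p \<longleftrightarrow> \<alpha> < \<gamma> \<and> f_mem R \<gamma> C p \<and> (\<exists>b. f_mem R (\<alpha>, b) x p) \<and> (\<exists>b. decides p \<alpha> b)"
    for \<alpha> \<gamma> p
  have ex_good: "\<exists>\<gamma> r. (p, r) \<in> R \<and> good \<alpha> \<gamma> r" if p: "(q, p) \<in> R" for p \<alpha>
  proof -
    obtain r\<^sub>1 \<gamma> where r\<^sub>1: "(p, r\<^sub>1) \<in> R" "\<alpha> < \<gamma>" "f_mem R \<gamma> C r\<^sub>1"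
      using f_clubD_unbounded[OF persistentD[OF persistent_f_club[OF trans] p C] refl_right[OF p]] by blast
    obtain r\<^sub>2 b where r\<^sub>2: "(r\<^sub>1, r\<^sub>2) \<in> R" "f_mem R (\<alpha>, b) x r\<^sub>2"
      using f_functionD_value[OF persistentD[OF persistent_f_function[OF trans] transR[OF p r\<^sub>1(1)] x] refl_right[OF r\<^sub>1(1)]]
      by blast
    obtain \<alpha>' where "\<alpha> < \<alpha>'"
      using ex_greater by blast
    moreover obtain r where "(r\<^sub>2, r) \<in> R" "\<forall>\<beta><\<alpha>'. \<exists>b. decides r \<beta> b"
      using decide_below[OF FieldI_right[OF r\<^sub>2(1)]] by blast
    ultimately show ?thesis
      unfolding good_def using r\<^sub>1 r\<^sub>2 mem_mono transR by meson
  qed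
  \<comment> \<open>The two directions \<open>P\<close> at a node, which disagree about the generic function at some \<open>\<beta> \<le> c\<close>.\<close>
  define stp where "stp p \<alpha> P c \<longleftrightarrow> (\<forall>i. (p, P i) \<in> R \<and> (\<exists>\<gamma>\<le>c. good \<alpha> \<gamma> (P i))) \<and>
      (\<exists>\<beta>\<le>c. \<forall>i. decides (P i) \<beta> i)" for p \<alpha> c and P :: "bool \<Rightarrow> 'p"
  have "\<exists>P c. stp p \<alpha> P c" if p: "(q, p) \<in> R" for p \<alpha>
  proof -
    obtain \<beta> p\<^sub>1 p\<^sub>0 where p\<^sub>1: "(p, p\<^sub>1) \<in> R" "decides p\<^sub>1 \<beta> True" and p\<^sub>0: "(p, p\<^sub>0) \<in> R" "decides p\<^sub>0 \<beta> False"
      using decide_both[OF FieldI_right[OF p]] by blast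
    obtain \<gamma>\<^sub>1 r\<^sub>1 where r\<^sub>1: "(p\<^sub>1, r\<^sub>1) \<in> R" "good \<alpha> \<gamma>\<^sub>1 r\<^sub>1"
      using ex_good[OF transR[OF p p\<^sub>1(1)]] by blast
    obtain \<gamma>\<^sub>0 r\<^sub>0 where r\<^sub>0: "(p\<^sub>0, r\<^sub>0) \<in> R" "good \<alpha> \<gamma>\<^sub>0 r\<^sub>0"
      using ex_good[OF transR[OF p p\<^sub>0(1)]] by blast
    define P where "P i = (if i then r\<^sub>1 else r\<^sub>0)" for i
    define c where "c = max (max \<gamma>\<^sub>1 \<gamma>\<^sub>0) \<beta>"
    have "\<gamma>\<^sub>1 \<le> c" "\<gamma>\<^sub>0 \<le> c" "\<beta> \<le> c"
      by (simp_all add: c_def le_max_iff_disj)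
    moreover have "decides (P i) \<beta> i" for i
      using decides_mono[OF r\<^sub>1(1) p\<^sub>1(2)] decides_mono[OF r\<^sub>0(1) p\<^sub>0(2)] by (cases i) (simp_all add: P_def)
    moreover have "(p, P i) \<in> R" for i
      using transR[OF p\<^sub>1(1) r\<^sub>1(1)] transR[OF p\<^sub>0(1) r\<^sub>0(1)] by (simp add: P_def)
    moreover have "\<exists>\<gamma>\<le>c. good \<alpha> \<gamma> (P i)" for i
      using r\<^sub>1(2) r\<^sub>0(2) \<open>\<gamma>\<^sub>1 \<le> c\<close> \<open>\<gamma>\<^sub>0 \<le> c\<close> by (cases i) (auto simp: P_def)
    ultimately have "stp p \<alpha> P c"
      unfolding stp_def by blast
    then show ?thesis
      by blast
  qed
  then have "\<forall>z. \<exists>w. (q, fst z) \<in> R \<longrightarrow> stp (fst z) (snd z) (fst w) (snd w)"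
    by auto
  from choice[OF this] obtain F where F: "\<forall>z. (q, fst z) \<in> R \<longrightarrow> stp (fst z) (snd z) (fst (F z)) (snd (F z))" ..
  define St where "St p \<alpha> = fst (F (p, \<alpha>))" for p \<alpha>
  define cc where "cc p \<alpha> = snd (F (p, \<alpha>))" for p \<alpha>
  have St: "stp p \<alpha> (St p \<alpha>) (cc p \<alpha>)" if "(q, p) \<in> R" for p \<alpha>
    using spec[OF F, of "(p, \<alpha>)"] that by (simp add: St_def cc_def)
  then have St_le: "(p, St p \<alpha> i) \<in> R" if "(q, p) \<in> R" for p \<alpha> i
    using that by (simp add: stp_def)
  define U where "U A = (SOME u. (q, u) \<in> R \<and> (\<forall>a\<in>A. (a, u) \<in> R))" for A
  define pl where "pl = run U St"
  define st where "st y \<alpha> = St (pl y \<alpha>) \<alpha> (y \<alpha>)" for y \<alpha>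
  have pl: "(q, pl y \<beta>) \<in> R \<and> (\<forall>\<alpha><\<beta>. (st y \<alpha>, pl y \<beta>) \<in> R)" for y \<beta>
  proof (induction \<beta> rule: less_induct)
    case (less \<beta>)
    have eq: "pl y \<beta> = U (st y ` {..<\<beta>})"
      unfolding pl_def st_def by (subst run.simps) simp
    have st_chain: "(st y i, st y j) \<in> R" if "i \<le> j" "j < \<beta>" for i j
    proof (cases "i = j")
      case True
      then show ?thesis
        using less.IH[of j] that St_le refl_right unfolding st_def by blast
    next
      case False
      then have "(st y i, pl y j) \<in> R" "(q, pl y j) \<in> R"
        using that less.IH[of j] by auto
      then show ?thesis
        unfolding st_def[of y j] using St_le transR by blast
    qed
    have "\<exists>u. (q, u) \<in> R \<and> (\<forall>a\<in>st y ` {..<\<beta>}. (a, u) \<in> R)"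
    proof (cases "\<exists>\<alpha>. \<alpha> < \<beta>")
      case True
      then obtain \<alpha> where \<alpha>: "\<alpha> < \<beta>" ..
      then obtain u where u: "\<forall>i<\<beta>. (st y i, u) \<in> R"
        using closed[of \<alpha> \<beta> "st y"] st_chain by blast
      have "(q, st y \<alpha>) \<in> R"
        unfolding st_def using less.IH[OF \<alpha>] St_le transR by blast
      then show ?thesis
        using u \<alpha> transR by blast
    next
      case False
      then show ?thesis
        using refl[OF q] by (intro exI[of _ q]) auto
    qed
    then have "(q, U (st y ` {..<\<beta>})) \<in> R \<and> (\<forall>a\<in>st y ` {..<\<beta>}. (a, U (st y ` {..<\<beta>})) \<in> R)"
      unfolding U_def by (rule someI_ex)
    then show ?case
      unfolding eq by blast
  qed
  have pl_agree: "pl y \<alpha> = pl y' \<alpha>" if "agree \<alpha> y y'" for y y' \<alpha>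
    unfolding pl_def using that by (rule run_agree)
  have st_stp: "stp (pl y \<alpha>) \<alpha> (St (pl y \<alpha>) \<alpha>) (cc (pl y \<alpha>) \<alpha>)" for y \<alpha>
    using St pl by blast
  have st_agree: "st y \<alpha> = st y' \<alpha>" if "agree \<beta> y y'" "\<alpha> < \<beta>" for y y' \<alpha> \<beta>
    unfolding st_def using pl_agree[OF agree_mono[OF that(1)], of \<alpha>] that by (simp add: agree_def)
  have st_good: "\<exists>\<gamma>\<le>cc (pl y \<alpha>) \<alpha>. good \<alpha> \<gamma> (st y \<alpha>)" for y \<alpha>
    using st_stp unfolding stp_def st_def by blast
  have st_Field: "st y \<alpha> \<in> Field R" for y \<alpha>
    using pl St_le FieldI_right unfolding st_def by blast
  define G where "G y \<alpha> = (SOME b. decides (st y \<alpha>) \<alpha> b)" for y \<alpha>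
  define X where "X y \<alpha> = (SOME b. f_mem R (\<alpha>, b) x (st y \<alpha>))" for y \<alpha>
  define c where "c y \<alpha> = cc (pl y \<alpha>) \<alpha>" for y \<alpha>
  have G: "decides (st y \<alpha>) \<alpha> (G y \<alpha>)" for y \<alpha>
  proof -
    have "\<exists>b. decides (st y \<alpha>) \<alpha> b"
      using st_good[of y \<alpha>] unfolding good_def by blast
    then show ?thesis
      unfolding G_def by (rule someI_ex)
  qed
  have X: "f_mem R (\<alpha>, X y \<alpha>) x (st y \<alpha>)" for y \<alpha>
  proof -
    have "\<exists>b. f_mem R (\<alpha>, b) x (st y \<alpha>)"
      using st_good[of y \<alpha>] unfolding good_def by blast
    then show ?thesis
      unfolding X_def by (rule someI_ex)
  qed
  have "\<exists>h. \<forall>\<delta>\<in>closure_points h. \<exists>y. agree \<delta> (D \<delta> (G y)) (X y) \<and> (\<forall>\<alpha><\<delta>. c y \<alpha> < \<delta>)"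
  proof (rule causal_guessingD[OF D])
    show "causal G"
      unfolding causal_def by (auto simp: agree_def[of _ "G _"] G_def dest: st_agree)
    show "causal X"
      unfolding causal_def by (auto simp: agree_def[of _ "X _"] X_def dest: st_agree)
    show "c y \<alpha> = c y' \<alpha>" if "agree \<alpha> y y'" for y y' \<alpha>
      using pl_agree[OF that] by (simp add: c_def)
    show "\<exists>\<beta>\<le>c y \<alpha>. G y \<beta> \<noteq> G y' \<beta>" if yy': "agree \<alpha> y y'" "y \<alpha> \<noteq> y' \<alpha>" for y y' \<alpha>
    proof -
      obtain \<beta> where \<beta>: "\<beta> \<le> c y \<alpha>" "\<forall>i. decides (St (pl y \<alpha>) \<alpha> i) \<beta> i"
        using st_stp[of y \<alpha>] unfolding stp_def c_def by blast
      \<comment> \<open>Every branch through this node passes through one of its two directions, which decides the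
          value at \<open>\<beta>\<close>; the value decided later, at step \<open>\<beta>\<close>, has to be the same.\<close>
      have "G z \<beta> = z \<alpha>" if z: "pl z \<alpha> = pl y \<alpha>" for z
      proof -
        obtain \<eta> where \<eta>: "\<alpha> < \<eta>" "\<beta> < \<eta>"
          using ex_greater_two by blast
        have "decides (pl z \<eta>) \<beta> (G z \<beta>)"
          using decides_mono G pl \<eta>(2) by blast
        moreover have "decides (st z \<alpha>) \<beta> (z \<alpha>)"
          using \<beta>(2) z by (simp add: st_def)
        then have "decides (pl z \<eta>) \<beta> (z \<alpha>)"
          using decides_mono pl \<eta>(1) by blast
        ultimately show ?thesis
          using decides_unique FieldI_right pl by blast
      qed
      from this[of y] this[of y'] show ?thesis
        using \<beta>(1) yy'(2) pl_agree[OF yy'(1)] by auto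
    qed
  qed
  then obtain h where h: "\<And>\<delta>. \<delta> \<in> closure_points h \<Longrightarrow>
      \<exists>y. agree \<delta> (D \<delta> (G y)) (X y) \<and> (\<forall>\<alpha><\<delta>. c y \<alpha> < \<delta>)"
    by blast
  obtain \<delta> where \<delta>: "\<delta> \<in> closure_points h" "\<delta> \<in> S"
    using S club_closure_points unfolding stationary_def by blast
  then obtain y where y: "agree \<delta> (D \<delta> (G y)) (X y)" "\<forall>\<alpha><\<delta>. c y \<alpha> < \<delta>"
    using h by blast
  have q_pl: "(q, pl y \<delta>) \<in> R" and st_pl: "\<And>\<alpha>. \<alpha> < \<delta> \<Longrightarrow> (st y \<alpha>, pl y \<delta>) \<in> R"
    using pl by blast+
  have "\<exists>r. (pl y \<delta>, r) \<in> R \<and> f_mem R \<delta> C r"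
  proof (rule f_clubD_closed)
    show "f_club R C (pl y \<delta>)"
      using persistentD[OF persistent_f_club[OF trans] q_pl C] .
    show "limit_ordinal \<delta>"
      using \<delta>(1) by (simp add: closure_points_def)
    show "\<exists>\<gamma>>\<beta>. \<gamma> < \<delta> \<and> f_mem R \<gamma> C (pl y \<delta>)" if "\<beta> < \<delta>" for \<beta>
    proof -
      obtain \<gamma> where \<gamma>: "\<gamma> \<le> c y \<beta>" "\<beta> < \<gamma>" "f_mem R \<gamma> C (st y \<beta>)"
        using st_good[of y \<beta>] unfolding good_def c_def by blast
      have "\<gamma> < \<delta>"
        using \<gamma>(1) y(2) that by (meson le_less_trans)
      then show ?thesis
        using \<gamma>(2) mem_mono[OF st_pl[OF that] \<gamma>(3)] by blast
    qed
  qed (use refl_right q_pl trans in blast)+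
  then obtain r where r: "(pl y \<delta>, r) \<in> R" "f_mem R \<delta> C r"
    by blast
  have "decides r \<beta> (G y \<beta>)" if "\<beta> < \<delta>" for \<beta>
    using decides_mono[OF transR[OF st_pl[OF that] r(1)] G] .
  moreover have "f_mem R (\<alpha>, D \<delta> (G y) \<alpha>) x r" if "\<alpha> < \<delta>" for \<alpha>
    using mem_mono[OF transR[OF st_pl[OF that] r(1)] X] y(1) that by (simp add: agree_def)
  ultimately show ?thesis
    using \<delta>(2) r transR[OF q_pl r(1)] by blast
qed

text \<open>
  By density it suffices that every condition forcing \<open>x\<close> to be a function and \<open>C\<close> to be a club has a
  strengthening that forces some \<open>\<delta> \<in> S\<close> into \<open>C\<close> and \<open>d\<^sub>\<delta> = x \<restriction> \<delta>\<close>.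
\<close>

theorem forced_diamond:
  fixes S :: "'k set"
  assumes card: "|seqs :: ('k \<rightharpoonup> 'k) set| =o ord_rel (UNIV :: 'k set)" and S: "stationary S"
  shows "forced R (f_diamond R S)"
proof -
  obtain D :: "'k \<Rightarrow> ('k \<Rightarrow> bool) \<Rightarrow> 'k \<Rightarrow> bool" where D: "causal_guessing D"
    using ex_causal_guessing[OF card] by (rule exE)
  let ?d = "guess_name D S"
  have guess: "\<exists>\<delta>\<in>S. \<exists>r. (q, r) \<in> R \<and> f_mem R \<delta> C r \<and> f_guess R ?d x \<delta> r"
    if q: "q \<in> Field R" "f_function R UNIV UNIV x q" "f_club R C q" for q x C
  proof -
    obtain \<delta> r g where r: "\<delta> \<in> S" "(q, r) \<in> R" "f_mem R \<delta> C r" "\<forall>\<beta><\<delta>. decides r \<beta> (g \<beta>)"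
        "\<forall>\<alpha><\<delta>. f_mem R (\<alpha>, D \<delta> g \<alpha>) x r"
      using ex_capturing_condition[OF S D q] by blast
    have "f_iff R (f_mem R ((\<delta>, \<alpha>), i) ?d) (f_mem R (\<alpha>, i) x) r" if "\<alpha> < \<delta>" for \<alpha> i
    proof -
      have "f_mem R ((\<delta>, \<alpha>), i) ?d s \<longleftrightarrow> f_mem R (\<alpha>, i) x s" if s: "(r, s) \<in> R" for s
      proof -
        note mono = persistentD[OF persistent_f_mem[OF trans] s]
        have d: "f_mem R ((\<delta>, \<alpha>), D \<delta> g \<alpha>) ?d s"
          using f_mem_guess_name[OF FieldI_right[OF r(2)] r(1) \<open>\<alpha> < \<delta>\<close> r(4)] by (rule mono)
        have x: "f_mem R (\<alpha>, D \<delta> g \<alpha>) x s"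
          using r(5) \<open>\<alpha> < \<delta>\<close> by (intro mono) blast
        have "f_function R (SIGMA \<delta>:S. {..<\<delta>}) UNIV ?d s"
          using FieldI_right[OF s] D by (rule f_function_guess_name)
        from f_functionD_unique[OF this refl_right[OF s] _ _ _ d, of i]
        have "f_mem R ((\<delta>, \<alpha>), i) ?d s \<Longrightarrow> i = D \<delta> g \<alpha>"
          using r(1) \<open>\<alpha> < \<delta>\<close> by auto
        moreover have "f_function R UNIV UNIV x s"
          using persistentD[OF persistent_f_function[OF trans] transR[OF r(2) s] q(2)] .
        from f_functionD_unique[OF this refl_right[OF s] _ _ _ x, of i]
        have "f_mem R (\<alpha>, i) x s \<Longrightarrow> i = D \<delta> g \<alpha>"
          by auto
        ultimately show ?thesis
          using d x by auto
      qed
      then show ?thesis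
        unfolding f_iff_def f_and_def f_imp_iff using refl_right by blast
    qed
    then have "f_guess R ?d x \<delta> r"
      by (simp add: f_guess_def f_ball_def)
    with r show ?thesis
      by blast
  qed
  have stat: "f_stationary R S (f_guess R ?d x) q" if "(p, q) \<in> R" "f_function R UNIV UNIV x q" for p q x
    unfolding f_stationary_def f_all_names_def f_imp_iff
  proof (intro allI impI)
    fix C :: "('k, 'p) name" and q' assume q': "(q, q') \<in> R" "f_club R C q'"
    have "f_bex R S (\<lambda>\<delta>. f_and (f_mem R \<delta> C) (f_guess R ?d x \<delta>)) q'"
      unfolding f_bex_iff f_and_def
    proof (intro allI impI guess)
      fix q'' assume q'': "(q', q'') \<in> R"
      show "q'' \<in> Field R"
        using FieldI_right[OF q''] .
      show "f_function R UNIV UNIV x q''"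
        using persistentD[OF persistent_f_function[OF trans] transR[OF q'(1) q''] that(2)] .
      show "f_club R C q''"
        using persistentD[OF persistent_f_club[OF trans] q'' q'(2)] .
    qed
    then show "\<exists>r. (q', r) \<in> R \<and> f_bex R S (\<lambda>\<delta>. f_and (f_mem R \<delta> C) (f_guess R ?d x \<delta>)) r"
      using refl_right[OF q'(1)] by blast
  qed
  have "f_and (f_function R (SIGMA \<delta>:S. {..<\<delta>}) UNIV ?d)
      (f_all_names (\<lambda>x. f_imp R (f_function R UNIV UNIV x) (f_stationary R S (f_guess R ?d x)))) p"
    if "p \<in> Field R" for p
    unfolding f_and_def f_all_names_def f_imp_iff
    using f_function_guess_name[OF that D] stat refl_right by blast
  then show ?thesis
    unfolding forced_def f_diamond_def
    by (intro ballI f_ex_namesI[where \<tau> = ?d]) (auto intro: refl_right FieldI_right)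
qed

end

section \<open>Silver forcing\<close>

lemma chain_map_union:
  fixes f :: "'k::wellorder \<Rightarrow> 'a \<rightharpoonup> 'b"
  assumes chain: "\<And>i j. i \<le> j \<Longrightarrow> j < \<beta> \<Longrightarrow> f i \<subseteq>\<^sub>m f j"
  shows "\<exists>u. (\<forall>i<\<beta>. f i \<subseteq>\<^sub>m u) \<and> dom u = (\<Union>i<\<beta>. dom (f i))"
proof -
  define I where "I \<gamma> = (LEAST i. \<gamma> \<in> dom (f i))" for \<gamma>
  define u where "u \<gamma> = (if I \<gamma> < \<beta> then f (I \<gamma>) \<gamma> else None)" for \<gamma>
  have le: "f i \<subseteq>\<^sub>m u" if "i < \<beta>" for i
    unfolding map_le_def
  proof
    fix \<gamma> assume \<gamma>: "\<gamma> \<in> dom (f i)"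
    then have "\<gamma> \<in> dom (f (I \<gamma>))" "I \<gamma> \<le> i"
      unfolding I_def by (rule LeastI) (use \<gamma> in \<open>rule Least_le\<close>)
    then show "f i \<gamma> = u \<gamma>"
      using chain[OF \<open>I \<gamma> \<le> i\<close> that] that by (auto simp: u_def map_le_def)
  qed
  moreover have "dom u = (\<Union>i<\<beta>. dom (f i))"
    using map_le_implies_dom_le[OF le] by (auto simp: u_def split: if_splits)
  ultimately show ?thesis
    by blast
qed

context regular_uncountable
begin

text \<open>
  A closure point of a function bounding the next elements of all the given clubs is a limit of, and
  hence belongs to, each of them.
\<close>

lemma nonstationary_UN:
  fixes A :: "'k \<Rightarrow> 'k set"
  assumes "\<And>i. i < \<beta> \<Longrightarrow> \<not> stationary (A i)"
  shows "\<not> stationary (\<Union>i<\<beta>. A i)"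
proof -
  have "\<forall>i. \<exists>C. i < \<beta> \<longrightarrow> club C \<and> C \<inter> A i = {}"
    using assms unfolding stationary_def by blast
  from choice[OF this] obtain C where C: "\<forall>i<\<beta>. club (C i) \<and> C i \<inter> A i = {}"
    by blast
  have "\<forall>\<xi>. \<exists>n. \<forall>i<\<beta>. n i \<in> C i \<and> \<xi> < n i"
  proof
    fix \<xi>
    have "\<forall>i. \<exists>\<gamma>. i < \<beta> \<longrightarrow> \<gamma> \<in> C i \<and> \<xi> < \<gamma>"
      using C unfolding club_def by blast
    from choice[OF this] show "\<exists>n. \<forall>i<\<beta>. n i \<in> C i \<and> \<xi> < n i"
      by blast
  qed
  from choice[OF this] obtain n where n: "\<forall>\<xi>. \<forall>i<\<beta>. n \<xi> i \<in> C i \<and> \<xi> < n \<xi> i" ..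
  have "\<forall>\<xi>. \<exists>\<sigma>. \<forall>i<\<beta>. n \<xi> i < \<sigma>"
    using image_lessThan_bounded by blast
  from choice[OF this] obtain h where h: "\<forall>\<xi>. \<forall>i<\<beta>. n \<xi> i < h \<xi>" ..
  have "\<delta> \<in> C i" if \<delta>: "\<delta> \<in> closure_points h" and i: "i < \<beta>" for \<delta> i
  proof -
    have "\<exists>\<gamma>\<in>C i. \<xi> < \<gamma> \<and> \<gamma> < \<delta>" if "\<xi> < \<delta>" for \<xi>
    proof -
      have "n \<xi> i < h \<xi>" "h \<xi> < \<delta>"
        using h i \<delta> that by (auto simp: closure_points_def)
      then show ?thesis
        using n i by (meson less_trans)
    qed
    moreover have "limit_ordinal \<delta>"
      using \<delta> by (simp add: closure_points_def)
    ultimately show ?thesis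
      using C i unfolding club_def by blast
  qed
  then have "closure_points h \<inter> (\<Union>i<\<beta>. A i) = {}"
    using C by blast
  then show ?thesis
    using club_closure_points unfolding stationary_def by blast
qed

lemma nonstationary_Un:
  fixes A B :: "'k set"
  assumes "\<not> stationary A" "\<not> stationary B"
  shows "\<not> stationary (A \<union> B)"
proof -
  obtain i j k :: 'k where "i < j" "j < k"
    using ex_greater by metis
  then have "A \<union> B = (\<Union>\<xi><k. if \<xi> = i then A else B)"
    by (auto split: if_splits intro: less_trans)
  moreover have "\<not> stationary (\<Union>\<xi><k. if \<xi> = i then A else B)"
    using assms by (intro nonstationary_UN) auto
  ultimately show ?thesis
    by simp
qed

lemma nonstationary_lessThan: "\<not> stationary {..<\<alpha>::'k}"
proof -
  have "club {\<alpha>..}"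
    unfolding club_def
  proof (intro conjI allI impI)
    show "\<exists>\<gamma>\<in>{\<alpha>..}. \<beta> < \<gamma>" for \<beta>
      using ex_greater_two[of \<alpha> \<beta>] by (auto intro: less_imp_le)
    show "\<delta> \<in> {\<alpha>..}" if "limit_ordinal \<delta>" "\<forall>\<beta><\<delta>. \<exists>\<gamma>\<in>{\<alpha>..}. \<beta> < \<gamma> \<and> \<gamma> < \<delta>" for \<delta>
      using that unfolding limit_ordinal_def by (metis atLeast_iff le_less_trans less_imp_le)
  qed
  moreover have "{\<alpha>..} \<inter> {..<\<alpha>} = {}"
    by auto
  ultimately show ?thesis
    unfolding stationary_def by blast
qed

lemma nonstationary_mono: "\<not> stationary B \<Longrightarrow> A \<subseteq> B \<Longrightarrow> \<not> stationary A"
  unfolding stationary_def by blast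

lemma Field_silver: "Field (silver :: ('k \<rightharpoonup> bool) rel) = {f. silver_condition f}"
  by (auto simp: silver_def Field_def)

text \<open>
  A condition is undefined somewhere, as its domain misses a club; this gives the two disagreeing
  strengthenings.  The generic function can be decided on any bounded set, since bounded sets are
  nonstationary.
\<close>

theorem silver_stem_forcing: "stem_forcing \<mu> silver (\<lambda>(f :: 'k \<rightharpoonup> bool) \<alpha> b. f \<alpha> = Some b)"
proof (unfold_locales, unfold Field_silver mem_Collect_eq)
  show "(f, f) \<in> silver" if "silver_condition f" for f :: "'k \<rightharpoonup> bool"
    using that by (simp add: silver_def)
  show "trans (silver :: ('k \<rightharpoonup> bool) rel)"
    by (auto simp: silver_def intro!: transI intro: map_le_trans)
  show "g \<alpha> = Some b" if "(f, g) \<in> silver" "f \<alpha> = Some b" for f g :: "'k \<rightharpoonup> bool" and \<alpha> b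
    using that by (auto simp: silver_def map_le_def dom_def)
  show "b = c" if "f \<alpha> = Some b" "f \<alpha> = Some c" for f :: "'k \<rightharpoonup> bool" and \<alpha> b c
    using that by simp
  show "\<exists>g. (f, g) \<in> silver \<and> (\<forall>\<beta><\<alpha>. \<exists>b. g \<beta> = Some b)" if f: "silver_condition f"
    for f :: "'k \<rightharpoonup> bool" and \<alpha>
  proof -
    define g where "g = (\<lambda>\<beta>. if \<beta> < \<alpha> then Some False else None) ++ f"
    have "dom g \<subseteq> {..<\<alpha>} \<union> dom f"
      by (auto simp: g_def split: if_splits)
    then have "silver_condition g"
      using f nonstationary_mono nonstationary_Un[OF nonstationary_lessThan] unfolding silver_condition_def by blast
    moreover have "f \<subseteq>\<^sub>m g"
      by (simp add: g_def)
    moreover have "\<exists>b. g \<beta> = Some b" if "\<beta> < \<alpha>" for \<beta>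
      using that by (auto simp: g_def map_add_def split: option.split)
    ultimately show ?thesis
      using f by (auto simp: silver_def)
  qed
  show "\<exists>\<alpha> g g'. (f, g) \<in> silver \<and> g \<alpha> = Some True \<and> (f, g') \<in> silver \<and> g' \<alpha> = Some False"
    if f: "silver_condition f" for f :: "'k \<rightharpoonup> bool"
  proof -
    obtain C where "club C" "C \<inter> dom f = {}"
      using f by (auto simp: silver_condition_def stationary_def)
    then obtain \<alpha> where \<alpha>: "\<alpha> \<notin> dom f"
      unfolding club_def by blast
    have "(f, f(\<alpha> \<mapsto> b)) \<in> silver" for b
    proof -
      obtain \<beta> where "\<alpha> < \<beta>"
        using ex_greater by blast
      then have "dom (f(\<alpha> \<mapsto> b)) \<subseteq> {..<\<beta>} \<union> dom f"
        by auto
      then have "silver_condition (f(\<alpha> \<mapsto> b))"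
        using f nonstationary_mono nonstationary_Un[OF nonstationary_lessThan] unfolding silver_condition_def by blast
      with f \<alpha> show ?thesis
        by (auto simp: silver_def map_le_def)
    qed
    then show ?thesis
      by (intro exI[of _ \<alpha>] exI[of _ "f(\<alpha> \<mapsto> True)"] exI[of _ "f(\<alpha> \<mapsto> False)"]) simp
  qed
  show "\<exists>g. \<forall>i<\<beta>. (f i, g) \<in> silver"
    if chain: "\<And>i j. i \<le> j \<Longrightarrow> j < \<beta> \<Longrightarrow> (f i, f j) \<in> silver" for \<beta> and f :: "'k \<Rightarrow> 'k \<rightharpoonup> bool"
  proof -
    have cond: "silver_condition (f i)" if "i < \<beta>" for i
      using chain[of i i] that by (auto simp: silver_def)
    have sub: "f i \<subseteq>\<^sub>m f j" if "i \<le> j" "j < \<beta>" for i j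
      using chain[OF that] by (auto simp: silver_def)
    have "\<exists>g. (\<forall>i<\<beta>. f i \<subseteq>\<^sub>m g) \<and> dom g = (\<Union>i<\<beta>. dom (f i))"
      using sub by (rule chain_map_union)
    then obtain g where g: "\<forall>i<\<beta>. f i \<subseteq>\<^sub>m g" "dom g = (\<Union>i<\<beta>. dom (f i))"
      by blast
    have "silver_condition g"
      unfolding silver_condition_def g(2) using cond by (intro nonstationary_UN) (auto simp: silver_condition_def)
    with cond g(1) show ?thesis
      by (auto simp: silver_def)
  qed
qed

end

section \<open>Splitting nodes of Sacks conditions\<close>

lemma seqsE:
  assumes "t \<in> seqs"
  obtains \<alpha> where "dom t = {..<\<alpha>}"
  using assms by (auto simp: seqs_def)

lemma seqs_dom_downward:
  assumes "t \<in> seqs" "\<gamma> \<in> dom t" "\<beta> \<le> \<gamma>"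
  shows "\<beta> \<in> dom t"
proof -
  obtain \<alpha> where "dom t = {..<\<alpha>}"
    using assms(1) by (rule seqsE)
  with assms(2,3) show ?thesis
    by simp
qed

lemma distinct_bools_exhaust: "b \<noteq> c \<Longrightarrow> P b \<Longrightarrow> P c \<Longrightarrow> P (i :: bool)"
  by (cases i; cases b; cases c) auto

lemma restrict_eq_of_map_le:
  assumes "s \<subseteq>\<^sub>m t"
  shows "t |` dom s = s"
  using assms by (auto simp: map_le_def restrict_map_def fun_eq_iff dom_def)

lemma restrict_map_le [simp]: "t |` A \<subseteq>\<^sub>m t"
  by (auto simp: map_le_def)

lemma lessThan_nested: "{..<\<alpha>::'k::wellorder} \<subseteq> {..<\<beta>} \<or> {..<\<beta>} \<subseteq> {..<\<alpha>}"
  by (cases "\<alpha> \<le> \<beta>") auto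

lemma seqs_compare:
  fixes s t :: "'k::wellorder \<rightharpoonup> 'b"
  assumes s: "s \<in> seqs" and t: "t \<in> seqs"
  shows "s \<subseteq>\<^sub>m t \<or> t \<subseteq>\<^sub>m s \<or> (\<exists>\<gamma>. \<gamma> \<in> dom s \<and> \<gamma> \<in> dom t \<and> s \<gamma> \<noteq> t \<gamma> \<and> s |` {..<\<gamma>} = t |` {..<\<gamma>})"
proof (cases "\<exists>\<gamma>. \<gamma> \<in> dom s \<and> \<gamma> \<in> dom t \<and> s \<gamma> \<noteq> t \<gamma>")
  case True
  define \<gamma> where "\<gamma> = (LEAST \<gamma>. \<gamma> \<in> dom s \<and> \<gamma> \<in> dom t \<and> s \<gamma> \<noteq> t \<gamma>)"
  have \<gamma>: "\<gamma> \<in> dom s \<and> \<gamma> \<in> dom t \<and> s \<gamma> \<noteq> t \<gamma>"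
    unfolding \<gamma>_def using True by (rule LeastI_ex)
  have "s \<beta> = t \<beta>" if "\<beta> < \<gamma>" for \<beta>
  proof -
    have "\<not> (\<beta> \<in> dom s \<and> \<beta> \<in> dom t \<and> s \<beta> \<noteq> t \<beta>)"
      using not_less_Least that unfolding \<gamma>_def by blast
    moreover have "\<beta> \<in> dom s" "\<beta> \<in> dom t"
      using seqs_dom_downward[OF s, of \<gamma> \<beta>] seqs_dom_downward[OF t, of \<gamma> \<beta>] \<gamma> less_imp_le[OF that]
      by blast+
    ultimately show ?thesis
      by blast
  qed
  then have "s |` {..<\<gamma>} = t |` {..<\<gamma>}"
    by (auto simp: restrict_map_def)
  with \<gamma> show ?thesis
    by blast
next
  case False
  moreover obtain \<alpha> \<beta> where "dom s = {..<\<alpha>}" "dom t = {..<\<beta>}"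
    using s t by (auto simp: seqs_def)
  then have "dom s \<subseteq> dom t \<or> dom t \<subseteq> dom s"
    using lessThan_nested[of \<alpha> \<beta>] by (simp only:)
  ultimately show ?thesis
    unfolding map_le_def by (metis subsetD)
qed

lemma initial_segments_compare:
  fixes s t u :: "'k::wellorder \<rightharpoonup> 'b"
  assumes "s \<in> seqs" "t \<in> seqs" "s \<subseteq>\<^sub>m u" "t \<subseteq>\<^sub>m u"
  shows "s \<subseteq>\<^sub>m t \<or> t \<subseteq>\<^sub>m s"
proof -
  have "\<not> (\<gamma> \<in> dom s \<and> \<gamma> \<in> dom t \<and> s \<gamma> \<noteq> t \<gamma>)" for \<gamma>
    using assms(3,4) by (metis map_le_def)
  then show ?thesis
    using seqs_compare[OF assms(1,2)] by blast
qed

text \<open>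
  A cofinal subset of a limit ordinal contains an increasing cofinal sequence indexed by an ordinal;
  the greedy enumeration of elements above all earlier ones must stop, since its values are never below
  their indices.
\<close>

lemma increasing_enumeration:
  fixes l :: "'k::wellorder"
  assumes l: "limit_ordinal l" and A: "\<And>\<alpha>. \<alpha> \<in> A \<Longrightarrow> \<alpha> < l" and cofinal: "\<And>\<beta>. \<beta> < l \<Longrightarrow> \<exists>\<alpha>\<in>A. \<beta> \<le> \<alpha>"
  shows "\<exists>(m :: 'k) f. limit_ordinal m \<and> (\<forall>i<m. f i \<in> A) \<and> (\<forall>j<m. \<forall>i<j. f i < f j) \<and>
    (\<forall>\<beta><l. \<exists>i<m. \<beta> \<le> f i)"
proof -
  have "\<exists>f :: 'k \<Rightarrow> 'k. \<forall>i. (\<exists>a\<in>A. \<forall>j<i. f j < a) \<longrightarrow> f i \<in> A \<and> (\<forall>j<i. f j < f i)"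
    by (rule dependent_wellorder_choice[where P = "\<lambda>f i r. (\<exists>a\<in>A. \<forall>j<i. f j < a) \<longrightarrow>
        r \<in> A \<and> (\<forall>j<i. f j < r)"]) auto
  then obtain f :: "'k \<Rightarrow> 'k" where f: "\<And>i. (\<exists>a\<in>A. \<forall>j<i. f j < a) \<Longrightarrow> f i \<in> A \<and> (\<forall>j<i. f j < f i)"
    by blast
  have "\<exists>i. \<not> (\<exists>a\<in>A. \<forall>j<i. f j < a)"
  proof (rule ccontr)
    assume "\<not> ?thesis"
    then have all: "f i \<in> A \<and> (\<forall>j<i. f j < f i)" for i
      using f by blast
    have "i \<le> f i" for i
    proof (induction i rule: less_induct)
      case (less i)
      then show ?case
        using all[of i] by (meson leD not_le_imp_less)
    qed
    with A all show False
      using leD by blast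
  qed
  define m where "m = (LEAST i. \<not> (\<exists>a\<in>A. \<forall>j<i. f j < a))"
  have "\<not> (\<exists>a\<in>A. \<forall>j<m. f j < a)"
    unfolding m_def by (rule LeastI_ex) fact
  then have end_m: "\<exists>j<m. a \<le> f j" if "a \<in> A" for a
    using that by (meson not_le_imp_less)
  have below_m: "f i \<in> A \<and> (\<forall>j<i. f j < f i)" if "i < m" for i
    using not_less_Least[of i "\<lambda>i. \<not> (\<exists>a\<in>A. \<forall>j<i. f j < a)"] that f unfolding m_def by blast
  have covers: "\<exists>i<m. \<beta> \<le> f i" if "\<beta> < l" for \<beta>
    using cofinal[OF that] end_m by (meson order_trans)
  have "limit_ordinal m"
    unfolding limit_ordinal_def
  proof (intro conjI allI impI)
    show "\<exists>\<beta>. \<beta> < m"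
      using l covers by (auto simp: limit_ordinal_def)
    show "\<exists>\<gamma>>\<beta>. \<gamma> < m" if \<beta>: "\<beta> < m" for \<beta>
    proof -
      have "f \<beta> < l"
        using A below_m[OF \<beta>] by blast
      then obtain \<eta> where "f \<beta> < \<eta>" "\<eta> < l"
        using l unfolding limit_ordinal_def by blast
      then obtain i where i: "i < m" "f \<beta> < f i"
        using covers by (meson less_le_trans)
      moreover have "\<beta> < i"
      proof (rule ccontr)
        assume "\<not> \<beta> < i"
        then have "i = \<beta> \<or> f i < f \<beta>"
          using below_m[OF \<beta>] by (auto simp: not_less le_less)
        with i(2) show False
          by auto
      qed
      ultimately show ?thesis
        by blast
    qed
  qed
  with below_m covers show ?thesis
    by (intro exI[of _ m] exI[of _ f]) blast
qed

context regular_uncountable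
begin

lemma atMost_eq_lessThan: "\<exists>\<beta>. {..\<alpha>::'k} = {..<\<beta>}"
proof -
  define \<beta> where "\<beta> = (LEAST \<beta>. \<alpha> < \<beta>)"
  have "\<alpha> < \<beta>"
    unfolding \<beta>_def using ex_greater by (rule LeastI_ex)
  moreover have "\<xi> \<le> \<alpha>" if "\<xi> < \<beta>" for \<xi>
    using not_less_Least[of \<xi> "\<lambda>\<beta>. \<alpha> < \<beta>"] that by (simp add: \<beta>_def not_less)
  ultimately have "{..\<alpha>} = {..<\<beta>}"
    by (auto intro: le_less_trans)
  then show ?thesis ..
qed

lemma lessThan_restrict_seqs: "t \<in> seqs \<Longrightarrow> t |` {..<\<gamma>::'k} \<in> seqs"
  unfolding seqs_def mem_Collect_eq dom_restrict by (metis inf.absorb1 inf.absorb2 lessThan_nested)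

lemma UN_lessThan: "\<exists>l. (\<Union>i<\<beta>::'k. {..<f i :: 'k}) = {..<l}"
proof -
  define l where "l = (LEAST \<sigma>. \<forall>i<\<beta>. f i \<le> \<sigma>)"
  have "\<exists>\<sigma>. \<forall>i<\<beta>. f i \<le> \<sigma>"
    using image_lessThan_bounded[of \<beta> f] by (auto intro: less_imp_le)
  then have "\<forall>i<\<beta>. f i \<le> l"
    unfolding l_def by (rule LeastI_ex)
  moreover have "\<exists>i<\<beta>. \<gamma> < f i" if "\<gamma> < l" for \<gamma>
    using not_less_Least[of \<gamma> "\<lambda>\<sigma>. \<forall>i<\<beta>. f i \<le> \<sigma>"] that by (auto simp: l_def not_le)
  ultimately have "(\<Union>i<\<beta>. {..<f i}) = {..<l}"
    by (fastforce intro: less_le_trans)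
  then show ?thesis ..
qed

lemma treeD: "tree p \<Longrightarrow> t \<in> p \<Longrightarrow> s \<in> seqs \<Longrightarrow> s \<subseteq>\<^sub>m t \<Longrightarrow> s \<in> p"
  unfolding tree_def by blast

lemma tree_seqs: "tree p \<Longrightarrow> t \<in> p \<Longrightarrow> t \<in> seqs"
  unfolding tree_def by blast

lemma tree_restrict: "tree p \<Longrightarrow> t \<in> p \<Longrightarrow> t |` {..<\<gamma>::'k} \<in> p"
  using treeD[of p t "t |` {..<\<gamma>}"] lessThan_restrict_seqs[of t \<gamma>] tree_seqs[of p t] by simp

lemma tree_restrict_atMost: "tree p \<Longrightarrow> t \<in> p \<Longrightarrow> t |` {..\<gamma>::'k} \<in> p"
  using tree_restrict atMost_eq_lessThan by metis

lemma empty_in_tree: "tree p \<Longrightarrow> (Map.empty :: 'k \<rightharpoonup> bool) \<in> p"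
proof -
  assume p: "tree p"
  then obtain t where "t \<in> p"
    unfolding tree_def by blast
  then have "t |` {..<(LEAST \<alpha>. True)} \<in> p"
    using tree_restrict[OF p] by blast
  moreover have "{..<(LEAST \<alpha>::'k. True)} = {}"
    using not_less_Least by blast
  ultimately show ?thesis
    by simp
qed

lemma splitting_node_iff:
  fixes p :: "('k \<rightharpoonup> bool) set"
  assumes p: "tree p" and dom: "dom s = {..<\<alpha>}"
  shows "splitting_node p s \<longleftrightarrow> (\<forall>i. s(\<alpha> \<mapsto> i) \<in> p)"
proof
  assume "splitting_node p s"
  then obtain t t' where t: "t \<in> p" "t' \<in> p" "t \<noteq> t'" "immediate_succ s t" "immediate_succ s t'"
    by (auto simp: splitting_node_def)
  have succ: "\<exists>b. t = s(\<alpha> \<mapsto> b)" if "immediate_succ s t" for t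
  proof -
    have st: "s \<subseteq>\<^sub>m t" "dom t = {..\<alpha>}"
      using that dom by (auto simp: immediate_succ_def lessThan_eq_iff)
    then obtain b where b: "t \<alpha> = Some b"
      by (metis atMost_iff domD order_refl)
    have "t \<beta> = (s(\<alpha> \<mapsto> b)) \<beta>" for \<beta>
    proof (cases "\<beta> \<in> dom s")
      case True
      then show ?thesis
        using st(1) dom by (auto simp: map_le_def)
    next
      case False
      then have "\<beta> \<notin> dom t \<or> \<beta> = \<alpha>"
        using dom st(2) by auto
      then show ?thesis
        using False b by (auto simp: domIff)
    qed
    then show ?thesis
      by blast
  qed
  obtain b b' where "t = s(\<alpha> \<mapsto> b)" "t' = s(\<alpha> \<mapsto> b')"
    using succ t by blast
  with t(1-3) show "\<forall>i. s(\<alpha> \<mapsto> i) \<in> p"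
    using distinct_bools_exhaust[of b b' "\<lambda>i. s(\<alpha> \<mapsto> i) \<in> p"] by blast
next
  assume succ: "\<forall>i. s(\<alpha> \<mapsto> i) \<in> p"
  have \<alpha>: "\<alpha> \<notin> dom s"
    using dom by simp
  then have le: "s \<subseteq>\<^sub>m s(\<alpha> \<mapsto> i)" for i
    by (auto simp: map_le_def)
  then have "s \<in> p"
    using treeD[OF p] succ dom by (auto simp: seqs_def)
  moreover have "immediate_succ s (s(\<alpha> \<mapsto> i))" for i
    using le dom by (auto simp: immediate_succ_def intro!: exI[of _ \<alpha>])
  moreover have "s(\<alpha> \<mapsto> True) \<noteq> s(\<alpha> \<mapsto> False)"
    by (simp add: fun_eq_iff)
  ultimately show "splitting_node p s"
    using succ unfolding splitting_node_def by blast
qed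

lemma splitting_node_mono: "splitting_node q s \<Longrightarrow> q \<subseteq> p \<Longrightarrow> splitting_node p s"
  unfolding splitting_node_def by blast

lemma splitting_nodeD: "splitting_node p s \<Longrightarrow> s \<in> p"
  unfolding splitting_node_def by blast

lemma restrict_dom:
  fixes s :: "'k \<rightharpoonup> bool"
  assumes "s \<in> seqs" "\<gamma> \<in> dom s"
  shows "dom (s |` {..<\<gamma>}) = {..<\<gamma>}"
proof -
  have "{..<\<gamma>} \<subseteq> dom s"
    using seqs_dom_downward[OF assms] less_imp_le by blast
  then show ?thesis
    by (simp add: Int_absorb1)
qed

text \<open>
  The two nodes pass through different immediate successors of their largest common initial segment.
\<close>

lemma meet_splits:
  fixes p :: "('k \<rightharpoonup> bool) set"
  assumes p: "tree p" and s: "s \<in> p" "\<gamma> \<in> dom s" and t: "t \<in> p" "\<gamma> \<in> dom t"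
    and differ: "s \<gamma> \<noteq> t \<gamma>" and meet: "s |` {..<\<gamma>} = t |` {..<\<gamma>}"
  shows "splitting_node p (s |` {..<\<gamma>})"
proof -
  have dom: "dom (s |` {..<\<gamma>}) = {..<\<gamma>}"
    using restrict_dom s tree_seqs[OF p] by blast
  have upd: "r |` {..\<gamma>} = (r |` {..<\<gamma>})(\<gamma> \<mapsto> b)" if "r \<gamma> = Some b" for r :: "'k \<rightharpoonup> bool" and b
    using that by (auto simp: restrict_map_def fun_eq_iff le_less)
  obtain b c where bc: "s \<gamma> = Some b" "t \<gamma> = Some c"
    using s t by blast
  have "(s |` {..<\<gamma>})(\<gamma> \<mapsto> b) \<in> p" "(s |` {..<\<gamma>})(\<gamma> \<mapsto> c) \<in> p"
    using tree_restrict_atMost[OF p s(1), of \<gamma>] tree_restrict_atMost[OF p t(1), of \<gamma>]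
      upd[of s b, OF bc(1)] upd[of t c, OF bc(2)] meet by simp_all
  moreover have "b \<noteq> c"
    using differ bc by simp
  ultimately show ?thesis
    unfolding splitting_node_iff[OF p dom]
    using distinct_bools_exhaust[of b c "\<lambda>i. (s |` {..<\<gamma>})(\<gamma> \<mapsto> i) \<in> p"] by blast
qed

lemma sacks_tree: "sacks_condition p \<Longrightarrow> tree p"
  by (simp add: sacks_condition_def)

lemma splitting_union:
  fixes p :: "('k \<rightharpoonup> bool) set" and l :: 'k
  assumes p: "sacks_condition p" and l: "limit_ordinal l" and f: "\<forall>i<l. splitting_node p (f i)"
      "\<forall>i j. i < j \<longrightarrow> j < l \<longrightarrow> f i \<subseteq>\<^sub>m f j \<and> f i \<noteq> f j" and u: "Map.graph u = (\<Union>i<l. Map.graph (f i))"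
  shows "splitting_node p u"
  using conjunct2[OF conjunct2[OF p[unfolded sacks_condition_def]], THEN spec[of _ l], THEN spec[of _ f]]
    l f u by blast

text \<open>
  The closure of the splitting nodes under unions of sequences, restated for a cofinal set of splitting
  initial segments.
\<close>

lemma splitting_limit:
  fixes p :: "('k \<rightharpoonup> bool) set"
  assumes p: "sacks_condition p" and l: "limit_ordinal l" and dom: "dom u = {..<l}"
    and cofinal: "\<And>\<beta>. \<beta> < l \<Longrightarrow> \<exists>\<alpha>. \<beta> \<le> \<alpha> \<and> \<alpha> < l \<and> splitting_node p (u |` {..<\<alpha>})"
  shows "splitting_node p u"
proof -
  let ?A = "{\<alpha>. \<alpha> < l \<and> splitting_node p (u |` {..<\<alpha>})}"
  have "\<exists>(m :: 'k) f. limit_ordinal m \<and> (\<forall>i<m. f i \<in> ?A) \<and> (\<forall>j<m. \<forall>i<j. f i < f j) \<and>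
      (\<forall>\<beta><l. \<exists>i<m. \<beta> \<le> f i)"
    using cofinal by (intro increasing_enumeration l) auto
  then obtain m :: 'k and f where m: "limit_ordinal m" and "\<forall>i<m. f i \<in> ?A" "\<forall>j<m. \<forall>i<j. f i < f j"
      "\<forall>\<beta><l. \<exists>i<m. \<beta> \<le> f i"
    by blast
  then have f: "\<And>i. i < m \<Longrightarrow> f i \<in> ?A" "\<And>i j. i < j \<Longrightarrow> j < m \<Longrightarrow> f i < f j"
      "\<And>\<beta>. \<beta> < l \<Longrightarrow> \<exists>i<m. \<beta> \<le> f i"
    by simp_all
  have "splitting_node p (u |` {..<f i})" if "i < m" for i
    using f(1)[OF that] by simp
  moreover have "u |` {..<f i} \<subseteq>\<^sub>m u |` {..<f j} \<and> u |` {..<f i} \<noteq> u |` {..<f j}" if "i < j" "j < m" for i j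
  proof
    show "u |` {..<f i} \<subseteq>\<^sub>m u |` {..<f j}"
      using f(2)[OF that] by (auto simp: map_le_def)
    have "f i \<in> dom (u |` {..<f j})" "f i \<notin> dom (u |` {..<f i})"
      using f(2)[OF that] f(1)[OF that(2)] dom by auto
    then show "u |` {..<f i} \<noteq> u |` {..<f j}"
      by metis
  qed
  moreover have "Map.graph u = (\<Union>i<m. Map.graph (u |` {..<f i}))"
  proof (rule set_eqI)
    fix z show "z \<in> Map.graph u \<longleftrightarrow> z \<in> (\<Union>i<m. Map.graph (u |` {..<f i}))"
    proof (cases z)
      case (Pair \<gamma> b)
      have "\<exists>i<m. \<gamma> < f i" if "u \<gamma> = Some b"
      proof -
        have "\<gamma> < l"
          using that dom by (metis domI lessThan_iff)
        then obtain \<gamma>' where "\<gamma> < \<gamma>'" "\<gamma>' < l"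
          using l by (auto simp: limit_ordinal_def)
        then show ?thesis
          using f(3) by (meson less_le_trans)
      qed
      then show ?thesis
        by (auto simp: Pair Map.graph_def restrict_map_def split: if_splits)
    qed
  qed
  ultimately show ?thesis
    using splitting_union[OF p m, of "\<lambda>i. u |` {..<f i}" u] by blast
qed

text \<open>
  Conditions are closed at limits also along paths on which the splitting nodes are bounded.  Beyond the
  last of them the tree has no choice, so a splitting node further up lies above the whole path.
\<close>

lemma limit_branch:
  fixes p :: "('k \<rightharpoonup> bool) set"
  assumes p: "sacks_condition p" and l: "limit_ordinal l" and dom: "dom t = {..<l}"
    and below: "\<And>\<beta>. \<beta> < l \<Longrightarrow> t |` {..<\<beta>} \<in> p"
  shows "t \<in> p"
proof (cases "\<forall>\<beta><l. \<exists>\<alpha>. \<beta> \<le> \<alpha> \<and> \<alpha> < l \<and> splitting_node p (t |` {..<\<alpha>})")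
  case True
  then show ?thesis
    using splitting_limit[OF p l dom] splitting_nodeD by blast
next
  case False
  then obtain \<alpha> where \<alpha>: "\<alpha> < l" and no_split: "\<And>\<beta>. \<alpha> \<le> \<beta> \<Longrightarrow> \<beta> < l \<Longrightarrow> \<not> splitting_node p (t |` {..<\<beta>})"
    by blast
  have t: "t \<in> seqs"
    using dom by (auto simp: seqs_def)
  obtain v where v: "t |` {..<\<alpha>} \<subseteq>\<^sub>m v" "splitting_node p v"
    using p below[OF \<alpha>] unfolding sacks_condition_def by blast
  then have vp: "v \<in> p" "v \<in> seqs"
    using splitting_nodeD tree_seqs[OF sacks_tree[OF p]] by blast+
  have dom_\<alpha>: "dom (t |` {..<\<alpha>}) = {..<\<alpha>}"
    using restrict_dom[OF t] \<alpha> dom by auto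
  from seqs_compare[OF vp(2) t] consider "v \<subseteq>\<^sub>m t" | "t \<subseteq>\<^sub>m v"
    | \<gamma> where "\<gamma> \<in> dom v" "\<gamma> \<in> dom t" "v \<gamma> \<noteq> t \<gamma>" "v |` {..<\<gamma>} = t |` {..<\<gamma>}"
    by blast
  then show ?thesis
  proof cases
    case 1
    obtain \<beta> where \<beta>: "dom v = {..<\<beta>}"
      using vp(2) by (rule seqsE)
    have "\<alpha> \<le> \<beta>" "\<beta> \<le> l"
      using map_le_implies_dom_le[OF v(1)] map_le_implies_dom_le[OF 1] dom_\<alpha> \<beta> dom by simp_all
    moreover have "v = t |` {..<\<beta>}"
      using restrict_eq_of_map_le[OF 1] \<beta> by simp
    ultimately have "\<beta> = l"
      using no_split[of \<beta>] v(2) by (auto simp: le_less)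
    then have "v = t"
      using \<open>v = t |` {..<\<beta>}\<close> dom restrict_eq_of_map_le[of t t] by simp
    with vp show ?thesis
      by simp
  next
    case 2
    then show ?thesis
      using treeD[OF sacks_tree[OF p] vp(1) t] by blast
  next
    case (3 \<gamma>)
    have "\<not> \<gamma> < \<alpha>"
    proof
      assume "\<gamma> < \<alpha>"
      then have "(t |` {..<\<alpha>}) \<gamma> = v \<gamma>"
        using v(1) dom_\<alpha> by (auto simp: map_le_def)
      with 3(3) \<open>\<gamma> < \<alpha>\<close> show False
        by simp
    qed
    moreover have "\<gamma> < l"
      using 3(2) dom by simp
    moreover have "splitting_node p (t |` {..<\<gamma>})"
    proof -
      obtain \<gamma>' where \<gamma>': "\<gamma> < \<gamma>'" "\<gamma>' < l"
        using l \<open>\<gamma> < l\<close> by (auto simp: limit_ordinal_def)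
      have "splitting_node p (v |` {..<\<gamma>})"
        using meet_splits[OF sacks_tree[OF p] vp(1) 3(1) below[OF \<gamma>'(2)]] 3 \<gamma>' dom
        by (auto simp: Int_absorb1 min_def)
      with 3(4) show ?thesis
        by simp
    qed
    ultimately show ?thesis
      using no_split by auto
  qed
qed

end

section \<open>Sacks forcing\<close>

context regular_uncountable
begin

lemma sacks_conditionI:
  fixes p :: "('k \<rightharpoonup> bool) set"
  assumes "tree p" and "\<And>s. s \<in> p \<Longrightarrow> \<exists>t. s \<subseteq>\<^sub>m t \<and> splitting_node p t"
    and "\<And>(l :: 'k) f u. limit_ordinal l \<Longrightarrow> \<forall>i<l. splitting_node p (f i) \<Longrightarrow>
      \<forall>i j. i < j \<longrightarrow> j < l \<longrightarrow> f i \<subseteq>\<^sub>m f j \<and> f i \<noteq> f j \<Longrightarrow>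
      Map.graph u = (\<Union>i<l. Map.graph (f i)) \<Longrightarrow> splitting_node p u"
  shows "sacks_condition p"
  unfolding sacks_condition_def using assms by (intro conjI allI ballI impI)

lemma sacks_extend:
  fixes p :: "('k \<rightharpoonup> bool) set"
  assumes p: "sacks_condition p" and s: "s \<in> p" and dom: "dom s = {..<\<alpha>}"
  shows "\<exists>b. s(\<alpha> \<mapsto> b) \<in> p"
proof -
  obtain v where v: "s \<subseteq>\<^sub>m v" "splitting_node p v"
    using p s unfolding sacks_condition_def by blast
  then have vp: "v \<in> p"
    using splitting_nodeD by blast
  show ?thesis
  proof (cases "\<alpha> \<in> dom v")
    case True
    then obtain b where b: "v \<alpha> = Some b"
      by blast
    have "v |` {..\<alpha>} = s(\<alpha> \<mapsto> b)"
    proof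
      fix \<beta> show "(v |` {..\<alpha>}) \<beta> = (s(\<alpha> \<mapsto> b)) \<beta>"
      proof (cases "\<beta> < \<alpha>")
        case True
        then have "s \<beta> = v \<beta>"
          using v(1) dom by (auto simp: map_le_def)
        with True show ?thesis
          by auto
      next
        case False
        then have "\<beta> \<noteq> \<alpha> \<Longrightarrow> s \<beta> = None"
          using dom by (auto simp: domIff[symmetric])
        with False b show ?thesis
          by (auto simp: restrict_map_def)
      qed
    qed
    then show ?thesis
      using tree_restrict_atMost[OF sacks_tree[OF p] vp, of \<alpha>] by metis
  next
    case False
    obtain \<beta> where "dom v = {..<\<beta>}"
      using tree_seqs[OF sacks_tree[OF p] vp] by (rule seqsE)
    with False have "dom v \<subseteq> {..<\<alpha>}"
      by auto
    then have "v = s"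
      using v(1) dom map_le_implies_dom_le[OF v(1)] restrict_eq_of_map_le[OF v(1)]
      by (metis restrict_eq_of_map_le map_le_refl subset_antisym)
    with v(2) show ?thesis
      using splitting_node_iff[OF sacks_tree[OF p] dom] by blast
  qed
qed

definition initial :: "('k \<Rightarrow> bool) \<Rightarrow> 'k \<Rightarrow> 'k \<rightharpoonup> bool" where
  "initial y \<alpha> = (\<lambda>\<beta>. if \<beta> < \<alpha> then Some (y \<beta>) else None)"

lemma dom_initial [simp]: "dom (initial y \<alpha>) = {..<\<alpha>}"
  by (auto simp: initial_def split: if_splits)

lemma initial_restrict: "\<beta> \<le> \<alpha> \<Longrightarrow> initial y \<alpha> |` {..<\<beta>} = initial y \<beta>"
  by (auto simp: initial_def restrict_map_def fun_eq_iff)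

text \<open>
  Follow extensions that stay in the tree; \<open>limit_branch\<close> takes care of the limits.  In particular a
  condition has nodes of every length.
\<close>

lemma sacks_branch:
  fixes p :: "('k \<rightharpoonup> bool) set"
  assumes p: "sacks_condition p"
  shows "\<exists>y. \<forall>\<alpha>. initial y \<alpha> \<in> p"
proof -
  have "\<exists>y. \<forall>\<alpha>. initial y \<alpha> \<in> p \<longrightarrow> (initial y \<alpha>)(\<alpha> \<mapsto> y \<alpha>) \<in> p"
  proof (rule dependent_wellorder_choice[where P = "\<lambda>y \<alpha> b. initial y \<alpha> \<in> p \<longrightarrow> (initial y \<alpha>)(\<alpha> \<mapsto> b) \<in> p"])
    fix b and y y' :: "'k \<Rightarrow> bool" and \<alpha>
    assume "\<And>\<beta>. \<beta> < \<alpha> \<Longrightarrow> y \<beta> = y' \<beta>"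
    then have "initial y \<alpha> = initial y' \<alpha>"
      by (auto simp: initial_def)
    then show "(initial y \<alpha> \<in> p \<longrightarrow> (initial y \<alpha>)(\<alpha> \<mapsto> b) \<in> p) =
        (initial y' \<alpha> \<in> p \<longrightarrow> (initial y' \<alpha>)(\<alpha> \<mapsto> b) \<in> p)"
      by simp
  next
    fix \<alpha> y
    show "\<exists>b. initial y \<alpha> \<in> p \<longrightarrow> (initial y \<alpha>)(\<alpha> \<mapsto> b) \<in> p"
      using sacks_extend[OF p _ dom_initial] by blast
  qed
  then obtain y where y: "\<And>\<alpha>. initial y \<alpha> \<in> p \<Longrightarrow> (initial y \<alpha>)(\<alpha> \<mapsto> y \<alpha>) \<in> p"
    by blast
  have "initial y \<alpha> \<in> p" for \<alpha>
  proof (induction \<alpha> rule: less_induct)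
    case (less \<alpha>)
    consider "limit_ordinal \<alpha>" | "\<nexists>\<beta>. \<beta> < \<alpha>" | \<beta> where "\<beta> < \<alpha>" "\<And>\<gamma>. \<gamma> < \<alpha> \<Longrightarrow> \<gamma> \<le> \<beta>"
      unfolding limit_ordinal_def by (meson not_le_imp_less)
    then show ?case
    proof cases
      case 1
      show ?thesis
        by (rule limit_branch[OF p 1 dom_initial]) (simp add: initial_restrict less.IH)
    next
      case 2
      then have "initial y \<alpha> = Map.empty"
        by (auto simp: initial_def)
      then show ?thesis
        using empty_in_tree[OF sacks_tree[OF p]] by simp
    next
      case (3 \<beta>)
      have "(initial y \<beta>)(\<beta> \<mapsto> y \<beta>) = initial y \<alpha>"
        using 3 by (auto simp: initial_def fun_eq_iff le_less dest: 3(2))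
      then show ?thesis
        using y[OF less.IH[OF 3(1)]] by simp
    qed
  qed
  then show ?thesis
    by blast
qed

text \<open>
  The strengthening of the condition \<open>p\<close> that makes its node \<open>t\<close> an initial segment of the generic
  branch.
\<close>

definition subtree :: "('k \<rightharpoonup> bool) set \<Rightarrow> ('k \<rightharpoonup> bool) \<Rightarrow> ('k \<rightharpoonup> bool) set" where
  "subtree p t = {s \<in> p. s \<subseteq>\<^sub>m t \<or> t \<subseteq>\<^sub>m s}"

lemma splitting_node_subtree:
  assumes p: "tree p" and t: "t \<in> p"
  shows "splitting_node (subtree p t) v \<longleftrightarrow> splitting_node p v \<and> t \<subseteq>\<^sub>m v"
proof
  assume split: "splitting_node (subtree p t) v"
  then have v: "v \<in> subtree p t"
    by (rule splitting_nodeD)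
  then have "v \<in> p"
    by (simp add: subtree_def)
  have "t \<subseteq>\<^sub>m v"
  proof (rule ccontr)
    assume not: "\<not> t \<subseteq>\<^sub>m v"
    then have "v \<subseteq>\<^sub>m t"
      using v by (auto simp: subtree_def)
    obtain w w' where w: "w \<in> subtree p t" "w' \<in> subtree p t" "w \<noteq> w'" "immediate_succ v w" "immediate_succ v w'"
      using split unfolding splitting_node_def by blast
    obtain \<alpha> where \<alpha>: "dom v = {..<\<alpha>}"
      using tree_seqs[OF p \<open>v \<in> p\<close>] by (rule seqsE)
    obtain \<beta> where \<beta>: "dom t = {..<\<beta>}"
      using tree_seqs[OF p t] by (rule seqsE)
    have "\<alpha> < \<beta>"
    proof (rule ccontr)
      assume "\<not> \<alpha> < \<beta>"
      then have "dom t \<subseteq> dom v"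
        using \<alpha> \<beta> by simp
      then have "t \<subseteq>\<^sub>m v"
        using \<open>v \<subseteq>\<^sub>m t\<close> unfolding map_le_def by (metis subsetD)
      with not show False ..
    qed
    have "u = t |` {..\<alpha>}" if u: "u \<in> subtree p t" "immediate_succ v u" for u
    proof -
      have dom_u: "dom u = {..\<alpha>}"
        using u(2) \<alpha> unfolding immediate_succ_def by auto
      then have "dom u \<subseteq> dom t"
        using \<alpha> \<beta> \<open>\<alpha> < \<beta>\<close> by auto
      moreover have "u \<subseteq>\<^sub>m t \<or> t \<subseteq>\<^sub>m u"
        using u(1) by (simp add: subtree_def)
      ultimately have "u \<subseteq>\<^sub>m t"
        by (metis map_le_def subsetD)
      then show ?thesis
        using restrict_eq_of_map_le[of u t] dom_u by simp
    qed
    with w show False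
      by metis
  qed
  moreover have "splitting_node p v"
    using split by (rule splitting_node_mono) (auto simp: subtree_def)
  ultimately show "splitting_node p v \<and> t \<subseteq>\<^sub>m v"
    by simp
next
  assume "splitting_node p v \<and> t \<subseteq>\<^sub>m v"
  then show "splitting_node (subtree p t) v"
    unfolding splitting_node_def immediate_succ_def subtree_def by (blast intro: map_le_trans)
qed

lemma sacks_condition_subtree:
  assumes p: "sacks_condition p" and t: "t \<in> p"
  shows "sacks_condition (subtree p t)"
proof -
  note tree_p = sacks_tree[OF p]
  note split = splitting_node_subtree[OF tree_p t]
  have "tree (subtree p t)"
    unfolding tree_def
  proof (intro conjI ballI impI)
    show "subtree p t \<noteq> {}"
      using t by (auto simp: subtree_def)
    show "subtree p t \<subseteq> seqs"
      using tree_seqs[OF tree_p] by (auto simp: subtree_def)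
    fix u s :: "'k \<rightharpoonup> bool"
    assume u: "u \<in> subtree p t" and s: "s \<in> seqs" "s \<subseteq>\<^sub>m u"
    then have "s \<in> p"
      using treeD[OF tree_p] by (auto simp: subtree_def)
    moreover have "s \<subseteq>\<^sub>m t \<or> t \<subseteq>\<^sub>m s"
    proof (cases "u \<subseteq>\<^sub>m t")
      case True
      then show ?thesis
        using s(2) map_le_trans by blast
    next
      case False
      then have "t \<subseteq>\<^sub>m u"
        using u by (simp add: subtree_def)
      then show ?thesis
        using initial_segments_compare s tree_seqs[OF tree_p t] by blast
    qed
    ultimately show "s \<in> subtree p t"
      by (simp add: subtree_def)
  qed
  moreover have "\<exists>v. s \<subseteq>\<^sub>m v \<and> splitting_node (subtree p t) v" if s: "s \<in> subtree p t" for s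
  proof (cases "t \<subseteq>\<^sub>m s")
    case True
    moreover obtain v where "s \<subseteq>\<^sub>m v" "splitting_node p v"
      using p s unfolding sacks_condition_def subtree_def by blast
    ultimately show ?thesis
      unfolding split using map_le_trans by blast
  next
    case False
    then have "s \<subseteq>\<^sub>m t"
      using s by (simp add: subtree_def)
    moreover obtain v where "t \<subseteq>\<^sub>m v" "splitting_node p v"
      using p t unfolding sacks_condition_def by blast
    ultimately show ?thesis
      unfolding split using map_le_trans by blast
  qed
  moreover have "splitting_node (subtree p t) u"
    if l: "limit_ordinal l" and f: "\<forall>i<l. splitting_node (subtree p t) (f i)"
      "\<forall>i j. i < j \<longrightarrow> j < l \<longrightarrow> f i \<subseteq>\<^sub>m f j \<and> f i \<noteq> f j" and u: "Map.graph u = (\<Union>i<l. Map.graph (f i))"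
    for l :: 'k and f u
  proof -
    have "splitting_node p u"
      using splitting_union[OF p l _ f(2) u] f(1) split by blast
    moreover obtain i where "i < l"
      using l unfolding limit_ordinal_def by blast
    then have "t \<subseteq>\<^sub>m f i"
      using f(1) split by blast
    moreover have "f i \<subseteq>\<^sub>m u"
      unfolding map_le_def
    proof
      fix \<beta> assume "\<beta> \<in> dom (f i)"
      then obtain b where b: "f i \<beta> = Some b"
        by blast
      then have "(\<beta>, b) \<in> Map.graph u"
        using \<open>i < l\<close> u by (auto simp: Map.graph_def)
      with b show "f i \<beta> = u \<beta>"
        by (simp add: Map.graph_def)
    qed
    ultimately show ?thesis
      unfolding split using map_le_trans by blast
  qed
  ultimately show ?thesis
    by (rule sacks_conditionI)
qed

text \<open>
  Among the splitting nodes above \<open>s\<close>, one of least length is an initial segment of every other one: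
  otherwise the two would meet in a shorter one.
\<close>

lemma least_splitting_node:
  fixes p :: "('k \<rightharpoonup> bool) set"
  assumes p: "sacks_condition p" and s: "s \<in> p"
  shows "\<exists>v. splitting_node p v \<and> s \<subseteq>\<^sub>m v \<and> (\<forall>w. splitting_node p w \<longrightarrow> s \<subseteq>\<^sub>m w \<longrightarrow> v \<subseteq>\<^sub>m w)"
proof -
  note tree_p = sacks_tree[OF p]
  define Q where "Q \<alpha> \<longleftrightarrow> (\<exists>v. splitting_node p v \<and> s \<subseteq>\<^sub>m v \<and> dom v = {..<\<alpha>})" for \<alpha>
  obtain v\<^sub>0 where v\<^sub>0: "s \<subseteq>\<^sub>m v\<^sub>0" "splitting_node p v\<^sub>0"
    using p s unfolding sacks_condition_def by blast
  obtain \<alpha>\<^sub>0 where "dom v\<^sub>0 = {..<\<alpha>\<^sub>0}"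
    using tree_seqs[OF tree_p splitting_nodeD[OF v\<^sub>0(2)]] by (rule seqsE)
  with v\<^sub>0 have "\<exists>\<alpha>. Q \<alpha>"
    unfolding Q_def by blast
  define \<alpha> where "\<alpha> = (LEAST \<alpha>. Q \<alpha>)"
  have "Q \<alpha>"
    unfolding \<alpha>_def using \<open>\<exists>\<alpha>. Q \<alpha>\<close> by (rule LeastI_ex)
  have minimal: "\<alpha> \<le> \<beta>" if "Q \<beta>" for \<beta>
    unfolding \<alpha>_def using that by (rule Least_le)
  obtain v where v: "splitting_node p v" "s \<subseteq>\<^sub>m v" "dom v = {..<\<alpha>}"
    using \<open>Q \<alpha>\<close> unfolding Q_def by blast
  have "v \<subseteq>\<^sub>m w" if w: "splitting_node p w" "s \<subseteq>\<^sub>m w" for w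
  proof -
    have vp: "v \<in> p" "v \<in> seqs" and wp: "w \<in> p" "w \<in> seqs"
      using v(1) w(1) splitting_nodeD tree_seqs[OF tree_p] by blast+
    from seqs_compare[OF vp(2) wp(2)] consider "v \<subseteq>\<^sub>m w" | "w \<subseteq>\<^sub>m v"
      | \<gamma> where "\<gamma> \<in> dom v" "\<gamma> \<in> dom w" "v \<gamma> \<noteq> w \<gamma>" "v |` {..<\<gamma>} = w |` {..<\<gamma>}"
      by blast
    then show ?thesis
    proof cases
      case 1
      then show ?thesis .
    next
      case 2
      obtain \<beta> where \<beta>: "dom w = {..<\<beta>}"
        using wp(2) by (rule seqsE)
      have "\<alpha> \<le> \<beta>"
        using minimal w \<beta> unfolding Q_def by blast
      then have "dom v \<subseteq> dom w"
        using v(3) \<beta> by simp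
      then show ?thesis
        using 2 unfolding map_le_def by (metis subsetD)
    next
      case (3 \<gamma>)
      have "splitting_node p (v |` {..<\<gamma>})"
        using meet_splits[OF tree_p vp(1) 3(1) wp(1) 3(2-4)] .
      moreover have "s \<subseteq>\<^sub>m v |` {..<\<gamma>}"
        unfolding map_le_def
      proof
        fix \<beta> assume \<beta>: "\<beta> \<in> dom s"
        have "\<gamma> \<notin> dom s"
          using v(2) w(2) 3(3) by (metis map_le_def)
        then have "\<beta> < \<gamma>"
          using seqs_dom_downward[OF tree_seqs[OF tree_p s] \<beta>, of \<gamma>] by (meson not_le_imp_less)
        then show "s \<beta> = (v |` {..<\<gamma>}) \<beta>"
          using v(2) \<beta> by (simp add: map_le_def)
      qed
      ultimately have "\<alpha> \<le> \<gamma>"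
        using minimal restrict_dom[OF vp(2) 3(1)] unfolding Q_def by blast
      with 3(1) v(3) show ?thesis
        by simp
    qed
  qed
  with v show ?thesis
    by blast
qed

lemma splitting_node_Inter:
  fixes f :: "'k \<Rightarrow> ('k \<rightharpoonup> bool) set"
  assumes f: "\<And>i. i < \<beta> \<Longrightarrow> tree (f i)" and q: "tree (\<Inter>i<\<beta>. f i)" and u: "u \<in> seqs"
  shows "splitting_node (\<Inter>i<\<beta>. f i) u \<longleftrightarrow> (\<forall>i<\<beta>. splitting_node (f i) u)"
proof -
  obtain \<alpha> where "dom u = {..<\<alpha>}"
    using u by (rule seqsE)
  then show ?thesis
    using splitting_node_iff[OF q] splitting_node_iff[OF f] by auto
qed

text \<open>
  Let \<open>v i\<close> be the least splitting node of \<open>f i\<close> above \<open>s\<close>.  For \<open>i \<le> j\<close> the node \<open>v j\<close> splits in \<open>f i\<close> too, so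
  \<open>v i\<close> is an initial segment of it.  The union of the \<open>v i\<close> is a limit of splitting nodes of each \<open>f i\<close>,
  or equal to \<open>v j\<close> for all large \<open>j\<close>.
\<close>

lemma common_splitting_node:
  fixes f :: "'k \<Rightarrow> ('k \<rightharpoonup> bool) set"
  assumes \<beta>: "\<alpha> < \<beta>" and f: "\<And>i. i < \<beta> \<Longrightarrow> sacks_condition (f i)"
    and chain: "\<And>i j. i \<le> j \<Longrightarrow> j < \<beta> \<Longrightarrow> f j \<subseteq> f i" and s: "\<And>i. i < \<beta> \<Longrightarrow> s \<in> f i"
  shows "\<exists>u. u \<in> seqs \<and> s \<subseteq>\<^sub>m u \<and> (\<forall>i<\<beta>. splitting_node (f i) u)"
proof -
  have "\<forall>i. \<exists>v. i < \<beta> \<longrightarrow> splitting_node (f i) v \<and> s \<subseteq>\<^sub>m v \<and>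
      (\<forall>w. splitting_node (f i) w \<longrightarrow> s \<subseteq>\<^sub>m w \<longrightarrow> v \<subseteq>\<^sub>m w)"
    using least_splitting_node[OF f s] by blast
  from choice[OF this] obtain v where v: "\<forall>i. i < \<beta> \<longrightarrow> splitting_node (f i) (v i) \<and> s \<subseteq>\<^sub>m v i \<and>
      (\<forall>w. splitting_node (f i) w \<longrightarrow> s \<subseteq>\<^sub>m w \<longrightarrow> v i \<subseteq>\<^sub>m w)" ..
  have split: "splitting_node (f i) (v j)" if "i \<le> j" "j < \<beta>" for i j
    using v that(2) by (intro splitting_node_mono[OF _ chain[OF that]]) simp
  have v_chain: "v i \<subseteq>\<^sub>m v j" if "i \<le> j" "j < \<beta>" for i j
  proof -
    have "i < \<beta>"
      using that by (rule le_less_trans)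
    then show ?thesis
      using v split[OF that] that(2) by blast
  qed
  have "\<exists>u. (\<forall>i<\<beta>. v i \<subseteq>\<^sub>m u) \<and> dom u = (\<Union>i<\<beta>. dom (v i))"
    using v_chain by (rule chain_map_union)
  then obtain u where u: "\<And>i. i < \<beta> \<Longrightarrow> v i \<subseteq>\<^sub>m u" "dom u = (\<Union>i<\<beta>. dom (v i))"
    by blast
  have "\<forall>i. \<exists>\<alpha>. i < \<beta> \<longrightarrow> dom (v i) = {..<\<alpha>}"
  proof (intro allI)
    fix i
    have "v i \<in> seqs" if "i < \<beta>"
      using split[OF order_refl that] by (intro tree_seqs[OF sacks_tree[OF f[OF that]]] splitting_nodeD)
    then show "\<exists>\<alpha>. i < \<beta> \<longrightarrow> dom (v i) = {..<\<alpha>}"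
      by (auto simp: seqs_def)
  qed
  from choice[OF this] obtain len where len: "\<forall>i. i < \<beta> \<longrightarrow> dom (v i) = {..<len i}" ..
  obtain l where "(\<Union>i<\<beta>. {..<len i}) = {..<l}"
    using UN_lessThan by blast
  with u(2) len have l: "dom u = {..<l}"
    by simp
  have v_eq: "v i = u |` {..<len i}" if "i < \<beta>" for i
    using restrict_eq_of_map_le[OF u(1)[OF that]] len that by simp
  have len_le: "len i \<le> l" if "i < \<beta>" for i
    using map_le_implies_dom_le[OF u(1)[OF that]] len that l by simp
  have later: "max i j < \<beta>" "i \<le> max i j" "j \<le> max i j" if "i < \<beta>" "j < \<beta>" for i j
    using that by auto
  have "splitting_node (f i) u" if i: "i < \<beta>" for i
  proof (cases "\<exists>j<\<beta>. len j = l")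
    case True
    then obtain j where j: "j < \<beta>" "len j = l"
      by blast
    let ?k = "max i j"
    have "len j \<le> len ?k"
      using map_le_implies_dom_le[OF v_chain[OF later(3,1)[OF i j(1)]]] len later[OF i j(1)] j(1) by simp
    then have "len ?k = l"
      using len_le[OF later(1)[OF i j(1)]] j(2) by simp
    then have "v ?k = u"
      using v_eq[OF later(1)[OF i j(1)]] l restrict_eq_of_map_le[of u u] by simp
    then show ?thesis
      using split[OF later(2,1)[OF i j(1)]] by simp
  next
    case False
    then have len_less: "len j < l" if "j < \<beta>" for j
      using len_le[OF that] that by (simp add: le_less)
    have beyond: "\<exists>k. i \<le> k \<and> k < \<beta> \<and> \<gamma> < len k" if \<gamma>: "\<gamma> < l" for \<gamma>
    proof -
      have "\<gamma> \<in> dom u"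
        using \<gamma> l by simp
      then obtain j where j: "j < \<beta>" "\<gamma> \<in> dom (v j)"
        using u(2) by auto
      have "\<gamma> \<in> dom (v (max i j))"
        using map_le_implies_dom_le[OF v_chain[OF later(3,1)[OF i j(1)]]] j(2) by blast
      then show ?thesis
        using later[OF i j(1)] len by (intro exI[of _ "max i j"]) auto
    qed
    show ?thesis
    proof (rule splitting_limit[OF f[OF i] _ l])
      have "len \<alpha> < l"
        using len_less \<beta> by blast
      then show "limit_ordinal l"
        unfolding limit_ordinal_def using beyond len_less by blast
      show "\<exists>\<alpha>. \<gamma> \<le> \<alpha> \<and> \<alpha> < l \<and> splitting_node (f i) (u |` {..<\<alpha>})" if "\<gamma> < l" for \<gamma>
      proof -
        obtain k where k: "i \<le> k" "k < \<beta>" "\<gamma> < len k"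
          using beyond[OF \<open>\<gamma> < l\<close>] by blast
        then show ?thesis
          using len_less[OF k(2)] split[OF k(1,2)] v_eq[OF k(2)] by (intro exI[of _ "len k"]) auto
      qed
    qed
  qed
  moreover have "u \<in> seqs"
    using l by (auto simp: seqs_def)
  moreover have "s \<subseteq>\<^sub>m u"
    using v u(1)[OF \<beta>] \<beta> map_le_trans by blast
  ultimately show ?thesis
    by blast
qed

lemma sacks_condition_Inter:
  fixes f :: "'k \<Rightarrow> ('k \<rightharpoonup> bool) set"
  assumes \<beta>: "\<alpha> < \<beta>" and f: "\<And>i. i < \<beta> \<Longrightarrow> sacks_condition (f i)"
    and chain: "\<And>i j. i \<le> j \<Longrightarrow> j < \<beta> \<Longrightarrow> f j \<subseteq> f i"
  shows "sacks_condition (\<Inter>i<\<beta>. f i)"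
proof -
  let ?q = "\<Inter>i<\<beta>. f i"
  have trees: "tree (f i)" if "i < \<beta>" for i
    using sacks_tree[OF f[OF that]] .
  have tree: "tree ?q"
    unfolding tree_def
  proof (intro conjI ballI impI)
    have "Map.empty \<in> ?q"
      using empty_in_tree[OF trees] by simp
    then show "?q \<noteq> {}"
      by blast
    show "?q \<subseteq> seqs"
      using tree_seqs[OF trees[OF \<beta>]] \<beta> by blast
    show "s \<in> ?q" if "t \<in> ?q" "s \<in> seqs" "s \<subseteq>\<^sub>m t" for s t
      using treeD[OF trees _ that(2,3)] that(1) by blast
  qed
  note split = splitting_node_Inter[OF trees tree]
  have "\<exists>u. s \<subseteq>\<^sub>m u \<and> splitting_node ?q u" if "s \<in> ?q" for s
  proof -
    have "\<exists>u. u \<in> seqs \<and> s \<subseteq>\<^sub>m u \<and> (\<forall>i<\<beta>. splitting_node (f i) u)"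
      using that by (intro common_splitting_node[OF \<beta> f chain]) auto
    then show ?thesis
      using split by blast
  qed
  moreover have "splitting_node ?q u"
    if l: "limit_ordinal l" and g: "\<forall>i<l. splitting_node ?q (g i)"
      "\<forall>i j. i < j \<longrightarrow> j < l \<longrightarrow> g i \<subseteq>\<^sub>m g j \<and> g i \<noteq> g j" and u: "Map.graph u = (\<Union>i<l. Map.graph (g i))"
    for l :: 'k and g u
  proof -
    have split_u: "splitting_node (f i) u" if i: "i < \<beta>" for i
    proof -
      have "?q \<subseteq> f i"
        using i by blast
      then have "\<forall>j<l. splitting_node (f i) (g j)"
        using g(1) splitting_node_mono by blast
      then show ?thesis
        using splitting_union[OF f[OF i] l _ g(2) u] by blast
    qed
    then have "u \<in> seqs"
      using tree_seqs[OF trees[OF \<beta>]] splitting_nodeD \<beta> by blast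
    then show ?thesis
      using split split_u by blast
  qed
  ultimately show ?thesis
    by (rule sacks_conditionI[OF tree])
qed

lemma Field_sacks: "Field (sacks :: ('k \<rightharpoonup> bool) set rel) = {p. sacks_condition p}"
  by (auto simp: sacks_def Field_def)

lemma subtree_stronger: "sacks_condition p \<Longrightarrow> t \<in> p \<Longrightarrow> (p, subtree p t) \<in> sacks"
  using sacks_condition_subtree by (auto simp: sacks_def subtree_def)

lemma subtree_decides: "s \<in> subtree p t \<Longrightarrow> t \<alpha> = Some b \<Longrightarrow> \<alpha> \<in> dom s \<Longrightarrow> s \<alpha> = Some b"
  unfolding subtree_def map_le_def by (metis (mono_tags, lifting) domI mem_Collect_eq)

text \<open>
  A condition decides a value of the generic branch when all its nodes of sufficient length agree on it.
  This is not vacuous, as there are such nodes.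
\<close>

theorem sacks_stem_forcing:
  "stem_forcing \<mu> sacks (\<lambda>(p :: ('k \<rightharpoonup> bool) set) \<alpha> b. \<forall>t\<in>p. \<alpha> \<in> dom t \<longrightarrow> t \<alpha> = Some b)"
proof (unfold_locales, unfold Field_sacks mem_Collect_eq)
  show "(p, p) \<in> sacks" if "sacks_condition p" for p :: "('k \<rightharpoonup> bool) set"
    using that by (simp add: sacks_def)
  show "trans (sacks :: ('k \<rightharpoonup> bool) set rel)"
    by (auto simp: sacks_def intro!: transI)
  show "\<forall>t\<in>q. \<alpha> \<in> dom t \<longrightarrow> t \<alpha> = Some b"
    if "(p, q) \<in> sacks" "\<forall>t\<in>p. \<alpha> \<in> dom t \<longrightarrow> t \<alpha> = Some b" for p q :: "('k \<rightharpoonup> bool) set" and \<alpha> b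
    using that unfolding sacks_def by blast
  show "b = c" if p: "sacks_condition p" and b: "\<forall>t\<in>p. \<alpha> \<in> dom t \<longrightarrow> t \<alpha> = Some b"
    and c: "\<forall>t\<in>p. \<alpha> \<in> dom t \<longrightarrow> t \<alpha> = Some c" for p :: "('k \<rightharpoonup> bool) set" and \<alpha> b c
  proof -
    obtain y where y: "\<forall>\<alpha>. initial y \<alpha> \<in> p"
      using sacks_branch[OF p] ..
    obtain \<beta> where "\<alpha> < \<beta>"
      using ex_greater by blast
    then have "\<alpha> \<in> dom (initial y \<beta>)"
      by simp
    then have "initial y \<beta> \<alpha> = Some b" "initial y \<beta> \<alpha> = Some c"
      using b c y by blast+
    then show ?thesis
      by simp
  qed
  show "\<exists>q. (p, q) \<in> sacks \<and> (\<forall>\<beta><\<alpha>. \<exists>b. \<forall>t\<in>q. \<beta> \<in> dom t \<longrightarrow> t \<beta> = Some b)"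
    if p: "sacks_condition p" for p :: "('k \<rightharpoonup> bool) set" and \<alpha>
  proof -
    obtain y where "\<forall>\<alpha>. initial y \<alpha> \<in> p"
      using sacks_branch[OF p] ..
    then have "(p, subtree p (initial y \<alpha>)) \<in> sacks"
      using subtree_stronger[OF p] by blast
    moreover have "initial y \<alpha> \<beta> = Some (y \<beta>)" if "\<beta> < \<alpha>" for \<beta>
      using that by (simp add: initial_def)
    ultimately show ?thesis
      using subtree_decides by blast
  qed
  show "\<exists>\<alpha> q q'. (p, q) \<in> sacks \<and> (\<forall>t\<in>q. \<alpha> \<in> dom t \<longrightarrow> t \<alpha> = Some True) \<and>
      (p, q') \<in> sacks \<and> (\<forall>t\<in>q'. \<alpha> \<in> dom t \<longrightarrow> t \<alpha> = Some False)"
    if p: "sacks_condition p" for p :: "('k \<rightharpoonup> bool) set"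
  proof -
    obtain s where s: "splitting_node p s"
      using p empty_in_tree[OF sacks_tree[OF p]] unfolding sacks_condition_def by blast
    obtain \<alpha> where \<alpha>: "dom s = {..<\<alpha>}"
      using tree_seqs[OF sacks_tree[OF p] splitting_nodeD[OF s]] by (rule seqsE)
    have "s(\<alpha> \<mapsto> b) \<in> p" for b
      using s splitting_node_iff[OF sacks_tree[OF p] \<alpha>] by simp
    then have stronger: "(p, subtree p (s(\<alpha> \<mapsto> b))) \<in> sacks" for b
      by (rule subtree_stronger[OF p])
    have decides: "\<forall>t\<in>subtree p (s(\<alpha> \<mapsto> b)). \<alpha> \<in> dom t \<longrightarrow> t \<alpha> = Some b" for b
      using subtree_decides[of _ p "s(\<alpha> \<mapsto> b)" \<alpha> b] by simp
    show ?thesis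
      using stronger[of True] decides[of True] stronger[of False] decides[of False] by blast
  qed
  show "\<exists>q. \<forall>i<\<beta>. (f i, q) \<in> sacks"
    if \<beta>: "\<alpha> < \<beta>" and chain: "\<And>i j. i \<le> j \<Longrightarrow> j < \<beta> \<Longrightarrow> (f i, f j) \<in> sacks"
    for \<alpha> \<beta> and f :: "'k \<Rightarrow> ('k \<rightharpoonup> bool) set"
  proof -
    have cond: "sacks_condition (f i)" if "i < \<beta>" for i
      using chain[of i i] that by (auto simp: sacks_def)
    have "sacks_condition (\<Inter>i<\<beta>. f i)"
      using chain by (intro sacks_condition_Inter[OF \<beta> cond]) (auto simp: sacks_def)
    with cond show ?thesis
      by (intro exI[of _ "\<Inter>i<\<beta>. f i"]) (auto simp: sacks_def)
  qed
qed

end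

section \<open>The diamond in Sacks and Silver extensions\<close>

theorem theorem1p2:
  fixes \<mu> :: "'k::wellorder" and S :: "'k set"
  assumes "infinite_regular_cardinal (ord_rel (UNIV :: 'k set))"
    and "limit_cardinal (ord_rel (UNIV :: 'k set))"
    and "|seqs :: ('k \<rightharpoonup> 'k) set| =o ord_rel (UNIV :: 'k set)"
    and "infinite_regular_cardinal (ord_rel {..<\<mu>})"
    and "S \<subseteq> {\<alpha>. cof \<alpha> = \<mu>}"
    and "stationary S"
  shows "forced (sacks :: ('k \<rightharpoonup> bool) set rel) (f_diamond sacks S) \<and>
         forced (silver :: ('k \<rightharpoonup> bool) rel) (f_diamond silver S)"
proof -
  have "Field (ord_rel {..<\<mu>}) = {..<\<mu>}"
    by (auto simp: ord_rel_def Field_def)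
  then have "infinite {..<\<mu>}"
    using assms(4) by (simp add: infinite_regular_cardinal_def cinfinite_def)
  then interpret regular_uncountable \<mu>
    using assms(1) by unfold_locales
  interpret sacks: stem_forcing \<mu> sacks "\<lambda>p \<alpha> b. \<forall>t\<in>p. \<alpha> \<in> dom t \<longrightarrow> t \<alpha> = Some b"
    by (rule sacks_stem_forcing)
  interpret silver: stem_forcing \<mu> silver "\<lambda>f \<alpha> b. f \<alpha> = Some b"
    by (rule silver_stem_forcing)
  show ?thesis
    using sacks.forced_diamond silver.forced_diamond assms(3,6) by blast
qed

end
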